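(* Let $(\Omega,\mathcal{F},\mathbb{P})$ be a countably generated probability space, $F,G$ real separable Hilbert spaces, $r\in\mathbb{N}$, $x\in L^2(\Omega;F)$ and $y\in L^2(\Omega;G)$. A solution to the problem $$\min\{\mathbb{E}\|x-Ay\|^2:\ A\in\mathcal{B}_{00,r}(G,F)\}\qquad(\ast)$$ exists if and only if $\operatorname{ran}\big(((C_y^{1/2})^\dagger C_{yx})_r\big)\subset\operatorname{ran}(C_y^{1/2})$ for some rank-$r$ truncated SVD $((C_y^{1/2})^\dagger C_{yx})_r$ of $(C_y^{1/2})^\dagger C_{yx}$. In that case, a solution that also satisfies the minimality property $\hat AP_{(\ker C_y)^\perp}=\hat A$ is given by $$\hat A=\Big((C_y^{1/2})^\dagger\big(P_{\overline{\operatorname{ran}C_y^{1/2}}}(C_y^{1/2})^\dagger C_{yx}\big)_r\Big)^*.$$ This solution is the only solution to $(\ast)$ which satisfies $\hat AP_{(\ker C_y)^\perp}=\hat A$ if and only if the rank-$r$ truncated SVD is unique.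
   Context: $L^2(\Omega;E)$ is the Lebesgue--Bochner space of square-integrable $E$-valued random variables. For $z\in L^2(\Omega;E_1)$, $w\in L^2(\Omega;E_2)$ the uncentered covariance $C_{wz}\in\mathcal{B}(E_1,E_2)$ is defined by $\langle C_{wz}e,f\rangle=\int_\Omega\langle w(\omega),f\rangle\langle e,z(\omega)\rangle\,d\mathbb{P}(\omega)$, and $C_z:=C_{zz}$ (positive, self-adjoint). The operator $(C_y^{1/2})^\dagger C_{yx}:F\to G$ is everywhere defined and Hilbert--Schmidt, with range in $\overline{\operatorname{ran}C_y^{1/2}}$. $\mathcal{B}(\mathcal{H},\mathcal{K})$: bounded everywhere-defined linear operators; $\mathcal{B}_{00,r}(\mathcal{H},\mathcal{K})$: those with range of dimension at most $r$. $P_V$: orthogonal projector onto a closed subspace $V$. Moore--Penrose inverse: for $T\in\mathcal{B}(\mathcal{H},\mathcal{K})$, $T^\dagger$ is the (possibly unbounded) linear operator with $\operatorname{dom}(T^\dagger)=\operatorname{ran}T\oplus(\operatorname{ran}T)^\perp$ and $T^\dagger(h+k)=(T|_{(\ker T)^\perp})^{-1}h$ for $h\in\operatorname{ran}T$, $k\in(\operatorname{ran}T)^\perp$. A compact operator $T$ has an SVD $T=\sum_i\sigma_i\langle\cdot,e_i\rangle f_i$ with nonincreasing singular values $\sigma_i$ and orthonormal systems $(e_i),(f_i)$; a rank-$r$ truncated SVD $(T)_r$ keeps the first $r$ terms (not unique in general). In the formula for $\hat A$, the truncated SVD is one satisfying the range inclusion.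
   Formalization: In the last sentence, "the rank-r truncated SVD is unique" means unique (as an operator) among the rank-r truncated SVDs whose range lies in ran(C_y^{1/2}); with uniqueness among all rank-r truncated SVDs the "only if" direction is false. *)

theory Defs
  imports "HOL-Probability.Probability"
begin

definition countably_generated :: "'a measure \<Rightarrow> bool" where
  "countably_generated M \<longleftrightarrow>
     (\<exists>E. countable E \<and> E \<subseteq> Pow (space M) \<and> sets M = sigma_sets (space M) E)"

(* Elements of L^2 are given by representatives rather than by almost-everywhere classes. *)
definition L2 :: "'a measure \<Rightarrow> ('a \<Rightarrow> 'b::{real_inner, banach, second_countable_topology}) set" where
  "L2 M = {z \<in> borel_measurable M. integrable M (\<lambda>\<omega>. (norm (z \<omega>))\<^sup>2)}"

(* Every THE below describes an object that exists uniquely in the cases of interest: here, for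
   square-integrable w and z, by the Riesz representation theorem. *)
definition cov ::
  "'a measure \<Rightarrow> ('a \<Rightarrow> 'c) \<Rightarrow> ('a \<Rightarrow> 'b) \<Rightarrow>
     'b::{real_inner, banach, second_countable_topology} \<Rightarrow>
     'c::{real_inner, banach, second_countable_topology}" where
  "cov M w z = (THE C. bounded_linear C \<and>
     (\<forall>e f. C e \<bullet> f = (\<integral>\<omega>. (w \<omega> \<bullet> f) * (e \<bullet> z \<omega>) \<partial>M)))"

(* Positivity alone does not imply self-adjointness over the reals. *)
definition positive_selfadjoint :: "('b::real_inner \<Rightarrow> 'b) \<Rightarrow> bool" where
  "positive_selfadjoint T \<longleftrightarrow>
     bounded_linear T \<and> (\<forall>u v. T u \<bullet> v = u \<bullet> T v) \<and> (\<forall>u. 0 \<le> T u \<bullet> u)"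

definition op_sqrt :: "('b::real_inner \<Rightarrow> 'b) \<Rightarrow> 'b \<Rightarrow> 'b" where
  "op_sqrt T = (THE S. positive_selfadjoint S \<and> S \<circ> S = T)"

definition ker :: "('b::real_vector \<Rightarrow> 'c::real_vector) \<Rightarrow> 'b set" where
  "ker T = {u. T u = 0}"

definition orth_proj :: "'b::real_inner set \<Rightarrow> 'b \<Rightarrow> 'b" where
  "orth_proj V u = (THE p. p \<in> V \<and> u - p \<in> orthogonal_comp V)"

definition mp_dom :: "('b::real_inner \<Rightarrow> 'c::real_inner) \<Rightarrow> 'c set" where
  "mp_dom T = {h + k |h k. h \<in> range T \<and> k \<in> orthogonal_comp (range T)}"

(* The Moore-Penrose inverse is a partial operator; as a HOL function it has the value 0
   outside its domain mp_dom T. *)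
definition mp_inv :: "('b::real_inner \<Rightarrow> 'c::real_inner) \<Rightarrow> 'c \<Rightarrow> 'b" where
  "mp_inv T v =
     (if v \<in> mp_dom T
      then inv_into (orthogonal_comp (ker T)) T (THE h. h \<in> range T \<and> v - h \<in> orthogonal_comp (range T))
      else 0)"

(* The rank is bounded through an explicit finite basis of the range, since the library
   function dim is 0 on infinite-dimensional spaces. *)
definition B00 :: "nat \<Rightarrow> ('b::real_normed_vector \<Rightarrow> 'c::real_normed_vector) set" where
  "B00 r = {A. bounded_linear A \<and>
     (\<exists>B. finite B \<and> card B \<le> r \<and> independent B \<and> span B = range A)}"

definition orthonormal_on :: "nat set \<Rightarrow> (nat \<Rightarrow> 'b::real_inner) \<Rightarrow> bool" where
  "orthonormal_on I e \<longleftrightarrow> (\<forall>i\<in>I. \<forall>j\<in>I. e i \<bullet> e j = (if i = j then 1 else 0))"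

(* Singular values are indexed from 0 and, for operators of finite rank, continued by zeros;
   the vectors e i, f i with s i = 0 are irrelevant and unconstrained.
   For compact T the condition that s tends to 0 is automatic; with it, the
   series converges in operator norm, so is_svd T s e f implies that T is compact. *)
definition is_svd ::
  "('b::real_inner \<Rightarrow> 'c::real_inner) \<Rightarrow> (nat \<Rightarrow> real) \<Rightarrow> (nat \<Rightarrow> 'b) \<Rightarrow> (nat \<Rightarrow> 'c) \<Rightarrow> bool" where
  "is_svd T s e f \<longleftrightarrow>
     decseq s \<and> (\<forall>i. 0 \<le> s i) \<and> s \<longlonglongrightarrow> 0 \<and>
     orthonormal_on {i. s i > 0} e \<and> orthonormal_on {i. s i > 0} f \<and>
     (\<forall>h. (\<lambda>i. (s i * (h \<bullet> e i)) *\<^sub>R f i) sums T h)"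

(* Truncated SVDs are compared as operators, the singular vectors being never unique. *)
definition is_truncated_svd ::
  "nat \<Rightarrow> ('b::real_inner \<Rightarrow> 'c::real_inner) \<Rightarrow> ('b \<Rightarrow> 'c) \<Rightarrow> bool" where
  "is_truncated_svd r T U \<longleftrightarrow>
     (\<exists>s e f. is_svd T s e f \<and> U = (\<lambda>h. \<Sum>i<r. (s i * (h \<bullet> e i)) *\<^sub>R f i))"

definition is_solution ::
  "'a measure \<Rightarrow> nat \<Rightarrow> ('a \<Rightarrow> 'f::{real_inner, banach, second_countable_topology}) \<Rightarrow>
     ('a \<Rightarrow> 'g::{real_inner, banach, second_countable_topology}) \<Rightarrow> ('g \<Rightarrow> 'f) \<Rightarrow> bool" where
  "is_solution M r x y A \<longleftrightarrow>
     is_arg_min (\<lambda>A. \<integral>\<omega>. (norm (x \<omega> - A (y \<omega>)))\<^sup>2 \<partial>M) (\<lambda>A. A \<in> B00 r) A"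

definition minimality :: "('g::real_inner \<Rightarrow> 'g) \<Rightarrow> ('g \<Rightarrow> 'f) \<Rightarrow> bool" where
  "minimality C A \<longleftrightarrow> A \<circ> orth_proj (orthogonal_comp (ker C)) = A"

end

theory Submission
  imports Defs
begin

text \<open>With \<open>S\<close> the square root of \<open>C\<^sub>y\<close> one has \<open>C\<^sub>y\<^sub>x = S T\<close>. An operator of rank at most \<open>r\<close> has the form
  \<open>A u = \<Sum>j<r. (u \<bullet> b j) a j\<close> with orthonormal \<open>a j\<close>, and expanding the square gives
  \<open>E \<parallel>x - A y\<parallel>\<^sup>2 = E \<parallel>x\<parallel>\<^sup>2 - (\<Sum>j<r. \<parallel>T (a j)\<parallel>\<^sup>2) + (\<Sum>j<r. \<parallel>T (a j) - S (b j)\<parallel>\<^sup>2)\<close>.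
  By Ky Fan's inequality the middle sum is at most the sum of the \<open>r\<close> largest squared singular values
  of \<open>T\<close>, and since \<open>T\<close> maps into the closure of \<open>ran S\<close>, this bound gives the infimum. It is attained
  by \<open>A\<close> iff the family \<open>a\<close> is optimal, that is, \<open>h \<mapsto> \<Sum>j<r. (h \<bullet> a j) T (a j)\<close> is a truncated SVD, and
  \<open>T (a j) = S (b j)\<close>, so that its range lies in \<open>ran S\<close>. Minimality then forces \<open>b j\<close> to be the
  Moore--Penrose preimage of \<open>T (a j)\<close>, so minimal solutions correspond to such truncated SVDs.\<close>

text \<open>Compactness has a single source: \<open>Cy\<close> and the Gram operator of
  \<open>T\<close>, that is \<open>B\<close> with
  \<open>B h \<bullet> k = T h \<bullet> T k\<close>, are both uncentered covariances, the second
  one of a square-summable coefficient sequence over the counting measure. One spectral theorem then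
  yields both the square root and the singular values. That \<open>T\<close> is everywhere defined
  and bounded is itself a result: a series \<open>R\<close> with values orthogonal to
  \<open>ker S\<close> and with \<open>S (R e) = Cyx e\<close> has to coincide with
  \<open>T\<close>. The obstacle is equality in Ky Fan's inequality. An optimal family need not
  consist of singular vectors, since any rotation inside its span is equally good, and repeated
  singular values leave the span itself undetermined. So a decomposition fixed in advance cannot be
  compared with it, and a new one has to be built around its span. This is why the spectral theorem
  is stated relative to a closed invariant subspace.\<close>

text \<open>Zero entries stand for missing vectors, so that families of every length are indexed by all
  natural numbers.\<close>

definition orthonormal_or_zero :: "(nat \<Rightarrow> 'b::real_inner) \<Rightarrow> bool" where
  "orthonormal_or_zero e \<longleftrightarrow> (\<forall>i j. e i \<bullet> e j = (if i = j \<and> e i \<noteq> 0 then 1 else 0))"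

section \<open>Orthonormal families, Bessel's inequality and Fourier series\<close>

lemma orthonormal_or_zeroD:
  assumes "orthonormal_or_zero e"
  shows "e i \<bullet> e j = (if i = j \<and> e i \<noteq> 0 then 1 else 0)"
  using assms unfolding orthonormal_or_zero_def by blast

lemma orthonormal_or_zero_norm_le:
  assumes "orthonormal_or_zero e"
  shows "norm (e i) \<le> 1"
  using orthonormal_or_zeroD[OF assms, of i i] by (auto simp: norm_eq_sqrt_inner)

lemma sum_scaleR_inner_orthonormal:
  assumes "orthonormal_or_zero e" "finite I"
  shows "(\<Sum>i\<in>I. c i *\<^sub>R e i) \<bullet> e j = (if j \<in> I \<and> e j \<noteq> 0 then c j else 0)"
proof -
  have "(\<Sum>i\<in>I. c i *\<^sub>R e i) \<bullet> e j = (\<Sum>i\<in>I. if j = i then (if e j \<noteq> 0 then c j else 0) else 0)"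
    unfolding inner_sum_left
    by (rule sum.cong) (auto simp: orthonormal_or_zeroD[OF assms(1)])
  then show ?thesis using assms(2) by simp
qed

lemma norm_sum_orthonormal:
  assumes "orthonormal_or_zero e" "finite I"
  shows "(norm (\<Sum>i\<in>I. c i *\<^sub>R e i))\<^sup>2 = (\<Sum>i\<in>I. if e i \<noteq> 0 then (c i)\<^sup>2 else 0)"
  unfolding power2_norm_eq_inner inner_sum_right inner_scaleR_right
    sum_scaleR_inner_orthonormal[OF assms]
  by (rule sum.cong) (auto simp: power2_eq_square)

lemma bessel_finite:
  assumes "orthonormal_or_zero e" "finite I"
  shows "(\<Sum>i\<in>I. (h \<bullet> e i)\<^sup>2) \<le> (norm h)\<^sup>2"
proof -
  define p where "p = (\<Sum>i\<in>I. (h \<bullet> e i) *\<^sub>R e i)"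
  have "p \<bullet> p = (\<Sum>i\<in>I. (h \<bullet> e i)\<^sup>2)"
    unfolding p_def power2_norm_eq_inner[symmetric] norm_sum_orthonormal[OF assms]
    by (rule sum.cong) auto
  moreover have "h \<bullet> p = (\<Sum>i\<in>I. (h \<bullet> e i)\<^sup>2)"
    by (simp add: p_def inner_sum_right power2_eq_square)
  moreover have "0 \<le> (h - p) \<bullet> (h - p)" by simp
  ultimately show ?thesis
    by (simp add: inner_diff_left inner_diff_right inner_commute power2_norm_eq_inner)
qed

lemma bessel_summable:
  assumes "orthonormal_or_zero e"
  shows "summable (\<lambda>i. (h \<bullet> e i)\<^sup>2)"
  by (rule summableI_nonneg_bounded[where x = "(norm h)\<^sup>2"]) (auto intro: bessel_finite[OF assms])

lemma summable_orthonormal: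
  fixes e :: "nat \<Rightarrow> 'b::{real_inner, banach}"
  assumes "orthonormal_or_zero e" "summable (\<lambda>i. (c i)\<^sup>2)"
  shows "summable (\<lambda>i. c i *\<^sub>R e i)"
  unfolding summable_Cauchy
proof (intro allI impI)
  fix d :: real assume "0 < d"
  then obtain N where N: "\<And>m n. m \<ge> N \<Longrightarrow> norm (\<Sum>i\<in>{m..<n}. (c i)\<^sup>2) < d\<^sup>2"
    using assms(2) unfolding summable_Cauchy by (meson zero_less_power)
  have "norm (\<Sum>i\<in>{m..<n}. c i *\<^sub>R e i) < d" if "m \<ge> N" for m n
  proof -
    have "(norm (\<Sum>i\<in>{m..<n}. c i *\<^sub>R e i))\<^sup>2 \<le> (\<Sum>i\<in>{m..<n}. (c i)\<^sup>2)"
      by (subst norm_sum_orthonormal[OF assms(1)]) (auto intro: sum_mono)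
    also have "\<dots> < d\<^sup>2" using N[OF that, of n] by simp
    finally show ?thesis using \<open>0 < d\<close> by (simp add: power2_less_imp_less)
  qed
  then show "\<exists>N. \<forall>m\<ge>N. \<forall>n. norm (\<Sum>i\<in>{m..<n}. c i *\<^sub>R e i) < d" by blast
qed

lemma suminf_orthonormal_inner:
  fixes e :: "nat \<Rightarrow> 'b::{real_inner, banach}"
  assumes "orthonormal_or_zero e" "summable (\<lambda>i. (c i)\<^sup>2)" "e j = 0 \<Longrightarrow> c j = 0"
  shows "(\<Sum>i. c i *\<^sub>R e i) \<bullet> e j = c j"
proof -
  have "(\<Sum>i. c i *\<^sub>R e i) \<bullet> e j = (\<Sum>i. (c i *\<^sub>R e i) \<bullet> e j)"
    by (rule bounded_linear.suminf[OF bounded_linear_inner_left summable_orthonormal[OF assms(1,2)]])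
  also have "\<dots> = (\<Sum>i. if i = j then c j else 0)"
    using assms(3) by (intro arg_cong[where f = suminf]) (auto simp: orthonormal_or_zeroD[OF assms(1)])
  also have "\<dots> = c j" using suminf_finite[of "{j}" "\<lambda>i. if i = j then c j else 0"] by simp
  finally show ?thesis .
qed

lemma closed_subspace_suminf:
  fixes v :: "nat \<Rightarrow> 'b::real_normed_vector"
  assumes "subspace V" "closed V" "\<And>n. v n \<in> V" "summable v"
  shows "suminf v \<in> V"
  using assms(2) _ summable_LIMSEQ[OF assms(4)]
  by (rule closed_sequentially) (auto intro: subspace_sum assms)

text \<open>For an orthonormal family in a complete space this is the orthogonal projection onto its
  closed span. As a series it exists by Bessel's inequality and completeness, with no nearest-point
  argument.\<close>

definition fourier_proj :: "(nat \<Rightarrow> 'b::real_inner) \<Rightarrow> 'b \<Rightarrow> 'b" where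
  "fourier_proj e h = (\<Sum>i. (h \<bullet> e i) *\<^sub>R e i)"

lemma fourier_proj_sums:
  fixes e :: "nat \<Rightarrow> 'b::{real_inner, banach}"
  assumes "orthonormal_or_zero e"
  shows "(\<lambda>i. (h \<bullet> e i) *\<^sub>R e i) sums fourier_proj e h"
  unfolding fourier_proj_def
  by (intro summable_sums summable_orthonormal bessel_summable assms)

lemma fourier_proj_orthogonal:
  fixes e :: "nat \<Rightarrow> 'b::{real_inner, banach}"
  assumes "orthonormal_or_zero e"
  shows "(h - fourier_proj e h) \<bullet> e j = 0"
  unfolding fourier_proj_def inner_diff_left
  by (subst suminf_orthonormal_inner) (auto intro: bessel_summable assms)

lemma fourier_proj_mem:
  fixes e :: "nat \<Rightarrow> 'b::{real_inner, banach}"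
  assumes "orthonormal_or_zero e" "subspace V" "closed V" "\<And>n. e n \<in> V"
  shows "fourier_proj e h \<in> V"
  unfolding fourier_proj_def
  by (intro closed_subspace_suminf assms subspace_scale summable_orthonormal bessel_summable)

definition compact_map :: "('b::metric_space \<Rightarrow> 'c::topological_space) \<Rightarrow> bool" where
  "compact_map B \<longleftrightarrow>
     (\<forall>u. bounded (range u) \<longrightarrow> (\<exists>r. strict_mono (r :: nat \<Rightarrow> nat) \<and> convergent (\<lambda>n. B (u (r n)))))"

text \<open>A diagonalisation of \<open>B\<close> on \<open>V\<close>. The last clause stands in for
  completeness of the eigenvectors: what they miss lies in the kernel. Zero eigenvalues carry the
  zero vector, so finite rank is no special case.\<close>

definition eigen_system ::
  "'b::real_inner set \<Rightarrow> ('b \<Rightarrow> 'b) \<Rightarrow> (nat \<Rightarrow> 'b) \<Rightarrow> (nat \<Rightarrow> real) \<Rightarrow> bool" where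
  "eigen_system V B e l \<longleftrightarrow>
     orthonormal_or_zero e \<and> (\<forall>n. e n \<in> V) \<and> decseq l \<and> (\<forall>n. 0 \<le> l n) \<and> l \<longlonglongrightarrow> 0 \<and>
     (\<forall>n. e n = 0 \<longleftrightarrow> l n = 0) \<and> (\<forall>n. B (e n) = l n *\<^sub>R e n) \<and>
     (\<forall>u\<in>V. (\<forall>n. u \<bullet> e n = 0) \<longrightarrow> B u = 0)"

subsection \<open>Compact positive operators\<close>

text \<open>The form evaluated at \<open>u + t *\<^sub>R v\<close> is a nonnegative polynomial in
  \<open>t\<close>. If its leading coefficient is positive, its minimum gives the inequality;
  otherwise it is affine and must have slope zero.\<close>

lemma positive_selfadjoint_Cauchy_Schwarz:
  assumes "positive_selfadjoint B"
  shows "(B u \<bullet> v)\<^sup>2 \<le> (B u \<bullet> u) * (B v \<bullet> v)"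
proof -
  interpret bounded_linear B using assms by (simp add: positive_selfadjoint_def)
  have sym: "B a \<bullet> b = a \<bullet> B b" and pos: "0 \<le> B a \<bullet> a" for a b
    using assms by (auto simp: positive_selfadjoint_def)
  have quad: "0 \<le> B u \<bullet> u + 2 * t * (B u \<bullet> v) + t\<^sup>2 * (B v \<bullet> v)" for t
  proof -
    have "B v \<bullet> u = B u \<bullet> v" using sym[of v u] by (simp add: inner_commute)
    then have "B (u + t *\<^sub>R v) \<bullet> (u + t *\<^sub>R v) = B u \<bullet> u + 2 * t * (B u \<bullet> v) + t\<^sup>2 * (B v \<bullet> v)"
      by (simp add: add scaleR inner_add_left inner_add_right power2_eq_square algebra_simps)
    with pos show ?thesis by metis
  qed
  show ?thesis
  proof (cases "B v \<bullet> v = 0")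
    case True
    have "B u \<bullet> v = 0"
    proof (rule ccontr)
      assume ne: "B u \<bullet> v \<noteq> 0"
      have "0 \<le> B u \<bullet> u + 2 * (- (B u \<bullet> u + 1) / (2 * (B u \<bullet> v))) * (B u \<bullet> v)"
        using quad[of "- (B u \<bullet> u + 1) / (2 * (B u \<bullet> v))"] True by simp
      also have "\<dots> = - 1" using ne by (simp add: field_simps)
      finally show False by simp
    qed
    then show ?thesis using True by simp
  next
    case False
    then have p: "B v \<bullet> v > 0" using pos[of v] by simp
    have "0 \<le> B u \<bullet> u - (B u \<bullet> v)\<^sup>2 / (B v \<bullet> v)"
      using quad[of "- (B u \<bullet> v) / (B v \<bullet> v)"] p by (simp add: power2_eq_square field_simps)
    then show ?thesis using p by (simp add: field_simps)
  qed
qed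

lemma positive_selfadjoint_eq_0:
  assumes "positive_selfadjoint B" "B u \<bullet> u \<le> 0"
  shows "B u = 0"
proof -
  have "0 \<le> B u \<bullet> u" using assms(1) unfolding positive_selfadjoint_def by blast
  then have "B u \<bullet> u = 0" using assms(2) by linarith
  then have "(B u \<bullet> B u)\<^sup>2 \<le> 0" using positive_selfadjoint_Cauchy_Schwarz[OF assms(1), of u "B u"] by simp
  then show ?thesis by simp
qed

text \<open>The quadratic form is maximised over the unit ball of \<open>V\<close>, with supremum
  \<open>l\<close>. Along a maximising sequence \<open>B (u n) - l *\<^sub>R u n\<close> tends to 0,
  so if \<open>l > 0\<close>, convergence of \<open>B (u n)\<close> along a subsequence carries over
  to \<open>u n\<close>, and the limit is an eigenvector. If \<open>l = 0\<close>, the zero vector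
  is returned.\<close>

lemma top_eigenvector:
  fixes B :: "'b::real_inner \<Rightarrow> 'b"
  assumes B: "positive_selfadjoint B" "compact_map B"
    and V: "subspace V" "closed V" "B ` V \<subseteq> V"
  shows "\<exists>e\<in>V. \<exists>l\<ge>0. B e = l *\<^sub>R e \<and> (if l = 0 then e = 0 else norm e = 1) \<and>
           (\<forall>u\<in>V. B u \<bullet> u \<le> l * (norm u)\<^sup>2)"
proof -
  interpret bounded_linear B using B by (simp add: positive_selfadjoint_def)
  have pos: "0 \<le> B a \<bullet> a" for a
    using B by (auto simp: positive_selfadjoint_def)
  define Q where "Q = {B u \<bullet> u |u. u \<in> V \<and> norm u \<le> 1}"
  define l where "l = Sup Q"
  obtain K where K: "\<And>u. norm (B u) \<le> norm u * K" "K \<ge> 0" using nonneg_bounded by blast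
  have QK: "q \<le> K" if "q \<in> Q" for q
  proof -
    obtain u where u: "q = B u \<bullet> u" "norm u \<le> 1" using \<open>q \<in> Q\<close> Q_def by blast
    have "q \<le> norm (B u) * norm u" using u norm_cauchy_schwarz by simp
    also have "\<dots> \<le> norm (B u) * 1" using u by (intro mult_left_mono) auto
    also have "\<dots> \<le> norm u * K" using K by simp
    also have "\<dots> \<le> 1 * K" using u K by (intro mult_right_mono) auto
    finally show ?thesis by simp
  qed
  have Q0: "0 \<in> Q" unfolding Q_def using V(1) subspace_0 zero by force
  have bdd: "bdd_above Q" using QK by (auto simp: bdd_above_def)
  have l0: "l \<ge> 0" unfolding l_def using cSup_upper[OF Q0 bdd] .
  have lmax: "B u \<bullet> u \<le> l * (norm u)\<^sup>2" if "u \<in> V" for u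
  proof (cases "u = 0")
    case False
    define w where "w = (1 / norm u) *\<^sub>R u"
    have "norm w = 1" "w \<in> V" using False that V(1) by (auto simp: w_def subspace_scale)
    then have "B w \<bullet> w \<in> Q" by (auto simp: Q_def)
    then have "B w \<bullet> w \<le> l" unfolding l_def using bdd by (rule cSup_upper)
    then show ?thesis using False by (simp add: w_def scaleR field_simps power2_eq_square)
  qed (simp add: zero)
  show ?thesis
  proof (cases "l = 0")
    case True
    then show ?thesis using V(1) subspace_0 zero lmax by (intro bexI[of _ 0] exI[of _ 0]) auto
  next
    case False
    with l0 have lp: "l > 0" by simp
    have "\<exists>u. u \<in> V \<and> norm u \<le> 1 \<and> l - inverse (real (Suc n)) < B u \<bullet> u" for n
    proof -
      have "l - inverse (real (Suc n)) < Sup Q" by (simp add: l_def)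
      then obtain q where "q \<in> Q" "l - inverse (real (Suc n)) < q"
        using less_cSup_iff[of Q] Q0 bdd by blast
      then show ?thesis by (auto simp: Q_def)
    qed
    then obtain u where u: "\<And>n. u n \<in> V" "\<And>n. norm (u n) \<le> 1"
      "\<And>n. l - inverse (real (Suc n)) < B (u n) \<bullet> u n" by metis
    have q_le: "B (u n) \<bullet> u n \<le> l" for n
      unfolding l_def using u bdd by (intro cSup_upper) (auto simp: Q_def)
    have q_lim: "(\<lambda>n. B (u n) \<bullet> u n) \<longlonglongrightarrow> l"
    proof (rule tendsto_sandwich[OF _ _ _ tendsto_const])
      show "(\<lambda>n. l - inverse (real (Suc n))) \<longlonglongrightarrow> l"
        using tendsto_diff[OF tendsto_const LIMSEQ_inverse_real_of_nat, of l] by simp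
    qed (use less_imp_le[OF u(3)] q_le in \<open>auto intro!: always_eventually\<close>)
    \<comment> \<open>Cauchy-Schwarz for the form at \<open>v\<close> and \<open>B v\<close>;
      \<open>lmax\<close> applies to \<open>B v\<close> because \<open>V\<close> is invariant. This
      is what makes the expansion in \<open>diff\<close> collapse to a multiple of
      \<open>l - B (u n) \<bullet> u n\<close>.\<close>
    have Bsq: "(norm (B v))\<^sup>2 \<le> l * (B v \<bullet> v)" if "v \<in> V" for v
    proof (cases "B v = 0")
      case False
      have "(B v \<bullet> B v)\<^sup>2 \<le> (B v \<bullet> v) * (B (B v) \<bullet> B v)"
        by (rule positive_selfadjoint_Cauchy_Schwarz[OF B(1)])
      also have "\<dots> \<le> (B v \<bullet> v) * (l * (norm (B v))\<^sup>2)"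
        using that V(3) by (intro mult_left_mono lmax pos) auto
      finally have "(B v \<bullet> B v) * (B v \<bullet> B v) \<le> (l * (B v \<bullet> v)) * (B v \<bullet> B v)"
        by (simp add: power2_eq_square algebra_simps dot_square_norm)
      then have "B v \<bullet> B v \<le> l * (B v \<bullet> v)" using False by simp
      then show ?thesis by (simp add: power2_norm_eq_inner)
    qed (use pos l0 in simp)
    have "bounded (range u)" using u(2) by (auto simp: bounded_iff)
    then obtain r where r: "strict_mono (r :: nat \<Rightarrow> nat)" "convergent (\<lambda>n. B (u (r n)))"
      using B(2) unfolding compact_map_def by blast
    then obtain w where w: "(\<lambda>n. B (u (r n))) \<longlonglongrightarrow> w" by (auto simp: convergent_def)
    have q_lim_r: "(\<lambda>n. B (u (r n)) \<bullet> u (r n)) \<longlonglongrightarrow> l"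
      using LIMSEQ_subseq_LIMSEQ[OF q_lim r(1)] by (simp add: o_def)
    have diff: "(norm (B (u n) - l *\<^sub>R u n))\<^sup>2 \<le> l * (l - B (u n) \<bullet> u n)" for n
    proof -
      have "(norm (B (u n) - l *\<^sub>R u n))\<^sup>2
          = (norm (B (u n)))\<^sup>2 - 2 * l * (B (u n) \<bullet> u n) + l\<^sup>2 * (norm (u n))\<^sup>2"
        unfolding power2_norm_eq_inner
        by (simp add: inner_diff_left inner_diff_right power2_eq_square inner_commute algebra_simps)
      also have "\<dots> \<le> l * (B (u n) \<bullet> u n) - 2 * l * (B (u n) \<bullet> u n) + l\<^sup>2 * 1"
        using Bsq[OF u(1), of n] u(2)[of n] by (intro add_mono diff_right_mono mult_left_mono) (auto simp: power_le_one)
      finally show ?thesis by (simp add: power2_eq_square algebra_simps)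
    qed
    have "(\<lambda>n. (norm (B (u (r n)) - l *\<^sub>R u (r n)))\<^sup>2) \<longlonglongrightarrow> 0"
    proof (rule tendsto_sandwich[OF _ _ tendsto_const])
      show "(\<lambda>n. l * (l - B (u (r n)) \<bullet> u (r n))) \<longlonglongrightarrow> 0"
        using tendsto_mult_left[OF tendsto_diff[OF tendsto_const q_lim_r], of l l] by simp
    qed (use diff in auto)
    then have "(\<lambda>n. sqrt ((norm (B (u (r n)) - l *\<^sub>R u (r n)))\<^sup>2)) \<longlonglongrightarrow> sqrt 0"
      by (rule tendsto_real_sqrt)
    then have "(\<lambda>n. B (u (r n)) - l *\<^sub>R u (r n)) \<longlonglongrightarrow> 0"
      by (simp add: tendsto_norm_zero_iff)
    from tendsto_diff[OF w this] have "(\<lambda>n. l *\<^sub>R u (r n)) \<longlonglongrightarrow> w" by simp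
    from tendsto_scaleR[OF tendsto_const this, of "1 / l"] lp
    have ulim: "(\<lambda>n. u (r n)) \<longlonglongrightarrow> (1 / l) *\<^sub>R w" by simp
    define e where "e = (1 / l) *\<^sub>R w"
    have ulim: "(\<lambda>n. u (r n)) \<longlonglongrightarrow> e" using ulim by (simp add: e_def)
    have eV: "e \<in> V" using closed_sequentially[OF V(2) _ ulim] u(1) by auto
    have "(\<lambda>n. B (u (r n))) \<longlonglongrightarrow> B e" using tendsto[OF ulim] .
    then have "B e = w" using w LIMSEQ_unique by blast
    then have Be: "B e = l *\<^sub>R e" using lp by (simp add: e_def)
    have "(\<lambda>n. B (u (r n)) \<bullet> u (r n)) \<longlonglongrightarrow> B e \<bullet> e" by (intro tendsto_inner tendsto ulim)
    then have "B e \<bullet> e = l" using q_lim_r LIMSEQ_unique by blast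
    then have "l * (norm e)\<^sup>2 = l" using Be by (simp add: power2_norm_eq_inner)
    then have "norm e = 1" using lp norm_ge_zero[of e] by (auto simp: power2_eq_1_iff)
    then show ?thesis using eV Be lmax l0 False by auto
  qed
qed

text \<open>Deflation: each new subspace is the orthogonal complement, inside the previous one, of
  the top eigenvector found there. If the eigenvalues stayed above some \<open>c > 0\<close>, the
  images of the orthonormal eigenvectors would keep mutual distance at least \<open>c\<close>,
  against compactness. A vector orthogonal to all of them lies in every subspace, so its form is
  bounded by a null sequence.\<close>

theorem eigen_system_exists:
  fixes B :: "'b::real_inner \<Rightarrow> 'b"
  assumes B: "positive_selfadjoint B" "compact_map B"
    and V: "subspace V" "closed V" "B ` V \<subseteq> V"
  shows "\<exists>e l. eigen_system V B e l"
proof -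
  interpret bounded_linear B using B by (simp add: positive_selfadjoint_def)
  have sym: "B a \<bullet> b = a \<bullet> B b" for a b
    using B by (auto simp: positive_selfadjoint_def)
  define P where "P x \<longleftrightarrow> (case x of (W, e, l) \<Rightarrow> subspace W \<and> closed W \<and> B ` W \<subseteq> W \<and> W \<subseteq> V \<and>
     e \<in> W \<and> l \<ge> 0 \<and> B e = l *\<^sub>R e \<and> (if l = 0 then e = 0 else norm e = 1) \<and>
     (\<forall>u\<in>W. B u \<bullet> u \<le> l * (norm u)\<^sup>2))" for x :: "'b set \<times> 'b \<times> real"
  define R where "R x y \<longleftrightarrow> fst y = {u \<in> fst x. u \<bullet> fst (snd x) = 0}"
    for x y :: "'b set \<times> 'b \<times> real"
  have ex: "\<exists>x. P x \<and> fst x = W"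
    if W: "subspace W" "closed W" "B ` W \<subseteq> W" "W \<subseteq> V" for W
  proof -
    obtain e l where "e \<in> W" "l \<ge> 0" "B e = l *\<^sub>R e" "if l = 0 then e = 0 else norm e = 1"
      "\<forall>u\<in>W. B u \<bullet> u \<le> l * (norm u)\<^sup>2"
      using top_eigenvector[OF B W(1-3)] by blast
    with W have "P (W, e, l)" by (simp only: P_def prod.case simp_thms)
    then show ?thesis by force
  qed
  \<comment> \<open>The choice runs over triples because the next subspace depends on the chosen
    eigenvector; the clause for \<open>n = 0\<close> pins the start of the chain to
    \<open>V\<close>.\<close>
  have "\<exists>f. \<forall>n. (P (f n) \<and> (n = 0 \<longrightarrow> fst (f n) = V)) \<and> R (f n) (f (Suc n))"
  proof (rule dependent_nat_choice)
    show "\<exists>x. P x \<and> ((0::nat) = 0 \<longrightarrow> fst x = V)" using ex[OF V] by auto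
  next
    fix x n assume x: "P x \<and> ((n::nat) = 0 \<longrightarrow> fst x = V)"
    obtain W e l where xe: "x = (W, e, l)" by (cases x)
    have W: "subspace W" "closed W" "B ` W \<subseteq> W" "W \<subseteq> V" and Be: "B e = l *\<^sub>R e"
      using x by (auto simp: P_def xe)
    let ?W = "{u \<in> W. u \<bullet> e = 0}"
    have "subspace ?W" using W(1) by (auto simp: subspace_def inner_add_left)
    moreover have "closed ?W"
      unfolding Collect_conj_eq using W(2) by (auto intro!: closed_Int closed_Collect_eq continuous_intros)
    moreover have "B ` ?W \<subseteq> ?W" using W(3) Be by (auto simp: sym)
    ultimately obtain y where "P y" "fst y = ?W" using ex[of ?W] W(4) by blast
    then show "\<exists>y. (P y \<and> (Suc n = 0 \<longrightarrow> fst y = V)) \<and> R x y"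
      by (intro exI[of _ y]) (simp add: R_def xe)
  qed
  then obtain f where f: "\<And>n. P (f n)" "fst (f 0) = V" "\<And>n. R (f n) (f (Suc n))" by metis
  define W e l where "W n = fst (f n)" and "e n = fst (snd (f n))" and "l n = snd (snd (f n))" for n
  have P: "W n \<subseteq> V" "e n \<in> W n" "l n \<ge> 0" "B (e n) = l n *\<^sub>R e n" "l n = 0 \<Longrightarrow> e n = 0"
    "l n \<noteq> 0 \<Longrightarrow> norm (e n) = 1" "\<And>u. u \<in> W n \<Longrightarrow> B u \<bullet> u \<le> l n * (norm u)\<^sup>2" for n
    using f(1)[of n] unfolding P_def W_def e_def l_def by (auto split: prod.splits if_splits)
  have W0: "W 0 = V" using f(2) by (simp add: W_def)
  have WS: "W (Suc n) = {u \<in> W n. u \<bullet> e n = 0}" for n using f(3)[of n] by (simp add: R_def W_def e_def)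
  have Wmono: "W n \<subseteq> W m" if "m \<le> n" for m n
    using that by (induction rule: dec_induct) (auto simp: WS)
  have orth_less: "e n \<bullet> e m = 0" if "m < n" for m n
    using P(2)[of n] Wmono[of "Suc m" n] that by (auto simp: WS)
  have e0: "e n = 0 \<longleftrightarrow> l n = 0" for n using P(5,6)[of n] by (cases "l n = 0") auto
  have orth: "orthonormal_or_zero e"
    unfolding orthonormal_or_zero_def
  proof (intro allI)
    fix i j :: nat
    consider "i < j" | "j < i" | "i = j" by (rule linorder_cases[of i j])
    then show "e i \<bullet> e j = (if i = j \<and> e i \<noteq> 0 then 1 else 0)"
    proof cases
      case 3
      then show ?thesis using P(6)[of i] e0[of i] by (auto simp: norm_eq_1)
    qed (use orth_less[of j i] orth_less[of i j] in \<open>auto simp: inner_commute\<close>)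
  qed
  have dec: "decseq l"
  proof (rule decseq_SucI)
    fix n
    show "l (Suc n) \<le> l n"
    proof (cases "l (Suc n) = 0")
      case False
      then have n1: "norm (e (Suc n)) = 1" using P(6) by blast
      have "l (Suc n) = B (e (Suc n)) \<bullet> e (Suc n)"
        using n1 by (simp add: P(4) dot_square_norm)
      also have "\<dots> \<le> l n * (norm (e (Suc n)))\<^sup>2" using P(2)[of "Suc n"] by (intro P(7)) (simp add: WS)
      finally show ?thesis using n1 by simp
    qed (use P(3) in simp)
  qed
  then obtain c where c: "l \<longlonglongrightarrow> c" "\<And>n. c \<le> l n"
    using decseq_convergent[of l 0] P(3) by blast
  have lim: "l \<longlonglongrightarrow> 0"
  proof -
    have c0: "c \<ge> 0" using c(1) P(3) by (intro LIMSEQ_le_const[OF c(1)]) auto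
    have False if "c > 0"
    proof -
      have "bounded (range e)"
        using orthonormal_or_zero_norm_le[OF orth] by (auto simp: bounded_iff)
      then obtain r where r: "strict_mono (r :: nat \<Rightarrow> nat)" "convergent (\<lambda>n. B (e (r n)))"
        using B(2) unfolding compact_map_def by blast
      then have "Cauchy (\<lambda>n. B (e (r n)))" by (simp add: convergent_Cauchy)
      then obtain N where N: "\<And>m n. m \<ge> N \<Longrightarrow> n \<ge> N \<Longrightarrow> norm (B (e (r m)) - B (e (r n))) < c"
        using \<open>c > 0\<close> unfolding Cauchy_iff by meson
      let ?m = "r N" and ?n = "r (Suc N)"
      have ne: "?m \<noteq> ?n" using strict_mono_eq[OF r(1)] by simp
      have nz: "e k \<noteq> 0" for k using c(2)[of k] \<open>c > 0\<close> e0[of k] by auto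
      have "(norm (B (e ?m) - B (e ?n)))\<^sup>2 = (l ?m)\<^sup>2 + (l ?n)\<^sup>2"
        unfolding power2_norm_eq_inner P(4)
        using ne nz by (simp add: inner_diff_left inner_diff_right orthonormal_or_zeroD[OF orth]
            power2_eq_square)
      also have "\<dots> \<ge> c\<^sup>2 + 0" using c(2)[of ?m] \<open>c > 0\<close> by (intro add_mono power_mono) auto
      finally have "c\<^sup>2 \<le> (norm (B (e ?m) - B (e ?n)))\<^sup>2" by simp
      then have "c \<le> norm (B (e ?m) - B (e ?n))" by (rule power2_le_imp_le) simp
      with N[of N "Suc N"] show False by simp
    qed
    with c0 c(1) show ?thesis by force
  qed
  have "B u = 0" if u: "u \<in> V" "\<forall>n. u \<bullet> e n = 0" for u
  proof -
    have "u \<in> W n" for n by (induction n) (use u in \<open>auto simp: W0 WS\<close>)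
    then have "B u \<bullet> u \<le> l n * (norm u)\<^sup>2" for n using P(7) by blast
    moreover have "(\<lambda>n. l n * (norm u)\<^sup>2) \<longlonglongrightarrow> 0"
      using tendsto_mult_right[OF lim] by simp
    ultimately have "B u \<bullet> u \<le> 0" by (intro LIMSEQ_le_const) auto
    then show ?thesis using positive_selfadjoint_eq_0[OF B(1)] by blast
  qed
  then have "eigen_system V B e l"
    unfolding eigen_system_def using orth dec lim P e0 by blast
  then show ?thesis by blast
qed

subsection \<open>Covariance operators\<close>

text \<open>Diagonal extraction along a countable dense set of test vectors; boundedness of the
  sequence extends convergence to all \<open>v\<close>.\<close>

lemma weakly_convergent_subsequence:
  fixes u :: "nat \<Rightarrow> 'b::{real_inner, second_countable_topology}"
  assumes "bounded (range u)"
  shows "\<exists>r. strict_mono (r :: nat \<Rightarrow> nat) \<and> (\<forall>v. convergent (\<lambda>n. u (r n) \<bullet> v))"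
proof -
  obtain K where K: "K > 0" "\<And>n. norm (u n) \<le> K"
    using assms by (auto simp: bounded_pos)
  obtain D :: "'b set" where D: "countable D" "\<And>X. open X \<Longrightarrow> X \<noteq> {} \<Longrightarrow> \<exists>d\<in>D. d \<in> X"
    by (erule countable_dense_setE)
  have "D \<noteq> {}" using D(2)[of UNIV] by auto
  define d where "d = from_nat_into D"
  have d: "range d = D" unfolding d_def by (rule range_from_nat_into[OF \<open>D \<noteq> {}\<close> D(1)])
  interpret subseqs "\<lambda>k s. convergent (\<lambda>n. u (s n) \<bullet> d k)"
  proof
    fix k and s :: "nat \<Rightarrow> nat"
    have "bounded (range (\<lambda>n. u (s n) \<bullet> d k))"
      unfolding bounded_iff
    proof (intro exI ballI)
      fix q assume "q \<in> range (\<lambda>n. u (s n) \<bullet> d k)"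
      then obtain n where "q = u (s n) \<bullet> d k" by blast
      then have "norm q \<le> norm (u (s n)) * norm (d k)" using Cauchy_Schwarz_ineq2 by simp
      also have "\<dots> \<le> K * norm (d k)" using K by (intro mult_right_mono) auto
      finally show "norm q \<le> K * norm (d k)" .
    qed
    then obtain l r where "strict_mono (r :: nat \<Rightarrow> nat)" "((\<lambda>n. u (s n) \<bullet> d k) \<circ> r) \<longlonglongrightarrow> l"
      using bounded_imp_convergent_subsequence by blast
    then show "\<exists>r. strict_mono r \<and> convergent (\<lambda>n. u ((s \<circ> r) n) \<bullet> d k)"
      by (auto simp: convergent_def o_def)
  qed
  define r where "r = diagseq"
  have r: "strict_mono r" unfolding r_def by (rule subseq_diagseq)
  have conv_d: "convergent (\<lambda>n. u (r n) \<bullet> d k)" for k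
  proof -
    \<comment> \<open>The diagonal sequence refines stage \<open>k\<close> only after its first
      \<open>Suc k\<close> entries, so convergence is obtained for the tail and then
      transferred.\<close>
    have "convergent (\<lambda>n. u ((diagseq \<circ> (+) (Suc k)) n) \<bullet> d k)"
    proof (rule diagseq_holds)
      fix r s :: "nat \<Rightarrow> nat" and n
      assume "strict_mono r" "convergent (\<lambda>m. u (s m) \<bullet> d n)"
      then show "convergent (\<lambda>m. u ((s \<circ> r) m) \<bullet> d n)"
        using convergent_subseq_convergent[of "\<lambda>m. u (s m) \<bullet> d n" r] by (simp add: o_def)
    qed
    then have "convergent (\<lambda>n. u (r (n + Suc k)) \<bullet> d k)" by (simp add: r_def add.commute)
    then show ?thesis using convergent_ignore_initial_segment[of "\<lambda>n. u (r n) \<bullet> d k" "Suc k"] by blast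
  qed
  have "convergent (\<lambda>n. u (r n) \<bullet> v)" for v
    unfolding Cauchy_convergent_iff[symmetric] Cauchy_iff
  proof (intro allI impI)
    fix c :: real assume "0 < c"
    \<comment> \<open>Replacing \<open>v\<close> by \<open>d k\<close> costs at most
      \<open>c / 4\<close> at each of the two indices, which leaves \<open>c / 2\<close> for the
      Cauchy property along \<open>d k\<close>.\<close>
    then have "ball v (c / (4 * K)) \<noteq> {}" using K(1) by (simp add: not_le)
    then obtain k where k: "d k \<in> ball v (c / (4 * K))" using D(2)[OF open_ball] d by (metis imageE)
    have "Cauchy (\<lambda>n. u (r n) \<bullet> d k)" using conv_d by (rule convergent_Cauchy)
    then obtain N where N: "\<And>m n. m \<ge> N \<Longrightarrow> n \<ge> N \<Longrightarrow> norm (u (r m) \<bullet> d k - u (r n) \<bullet> d k) < c / 2"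
      using \<open>0 < c\<close> unfolding Cauchy_iff by (meson half_gt_zero)
    have "norm (u (r m) \<bullet> v - u (r n) \<bullet> v) < c" if "m \<ge> N" "n \<ge> N" for m n
    proof -
      have close: "\<bar>u i \<bullet> (v - d k)\<bar> \<le> c / 4" for i
      proof -
        have "\<bar>u i \<bullet> (v - d k)\<bar> \<le> norm (u i) * norm (v - d k)" by (rule Cauchy_Schwarz_ineq2)
        also have "\<dots> \<le> K * (c / (4 * K))" using K k by (intro mult_mono) (auto simp: dist_norm)
        finally show ?thesis using K by simp
      qed
      show ?thesis using close[of "r m"] close[of "r n"] N[OF that]
        unfolding real_norm_def inner_diff_right by linarith
    qed
    then show "\<exists>N. \<forall>m\<ge>N. \<forall>n\<ge>N. norm (u (r m) \<bullet> v - u (r n) \<bullet> v) < c" by blast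
  qed
  then show ?thesis using r by blast
qed

lemma L2_measurable [measurable_dest]: "z \<in> L2 M \<Longrightarrow> z \<in> borel_measurable M"
  by (simp add: L2_def)

lemma L2_integrable_mult_norm:
  assumes "w \<in> L2 M" "z \<in> L2 M"
  shows "integrable M (\<lambda>\<omega>. norm (w \<omega>) * norm (z \<omega>))"
proof (rule Bochner_Integration.integrable_bound)
  show "integrable M (\<lambda>\<omega>. (norm (w \<omega>))\<^sup>2 + (norm (z \<omega>))\<^sup>2)"
    using assms by (auto simp: L2_def)
  show "(\<lambda>\<omega>. norm (w \<omega>) * norm (z \<omega>)) \<in> borel_measurable M" using assms by measurable
  show "AE \<omega> in M. norm (norm (w \<omega>) * norm (z \<omega>)) \<le> norm ((norm (w \<omega>))\<^sup>2 + (norm (z \<omega>))\<^sup>2)"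
  proof (intro always_eventually allI)
    fix \<omega>
    have "2 * (norm (w \<omega>) * norm (z \<omega>)) \<le> (norm (w \<omega>))\<^sup>2 + (norm (z \<omega>))\<^sup>2"
      using sum_squares_bound[of "norm (w \<omega>)" "norm (z \<omega>)"] by simp
    moreover have "0 \<le> norm (w \<omega>) * norm (z \<omega>)" by simp
    ultimately show "norm (norm (w \<omega>) * norm (z \<omega>)) \<le> norm ((norm (w \<omega>))\<^sup>2 + (norm (z \<omega>))\<^sup>2)"
      unfolding real_norm_def by linarith
  qed
qed

lemma L2_integrable_scaleR:
  assumes "w \<in> L2 M" "z \<in> L2 M"
  shows "integrable M (\<lambda>\<omega>. (e \<bullet> z \<omega>) *\<^sub>R w \<omega>)"
proof (rule Bochner_Integration.integrable_bound)
  show "integrable M (\<lambda>\<omega>. norm e * (norm (w \<omega>) * norm (z \<omega>)))"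
    using L2_integrable_mult_norm[OF assms] by simp
  show "(\<lambda>\<omega>. (e \<bullet> z \<omega>) *\<^sub>R w \<omega>) \<in> borel_measurable M" using assms by measurable
  show "AE \<omega> in M. norm ((e \<bullet> z \<omega>) *\<^sub>R w \<omega>) \<le> norm (norm e * (norm (w \<omega>) * norm (z \<omega>)))"
  proof (intro always_eventually allI)
    fix \<omega>
    have "\<bar>e \<bullet> z \<omega>\<bar> * norm (w \<omega>) \<le> (norm e * norm (z \<omega>)) * norm (w \<omega>)"
      by (intro mult_right_mono Cauchy_Schwarz_ineq2) simp
    then show "norm ((e \<bullet> z \<omega>) *\<^sub>R w \<omega>) \<le> norm (norm e * (norm (w \<omega>) * norm (z \<omega>)))"
      by (simp add: abs_mult mult_ac)
  qed
qed

lemma L2_integrable_inner_mult: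
  assumes "w \<in> L2 M" "z \<in> L2 M"
  shows "integrable M (\<lambda>\<omega>. (w \<omega> \<bullet> f) * (e \<bullet> z \<omega>))"
  using integrable_inner_left[of f M "\<lambda>\<omega>. (e \<bullet> z \<omega>) *\<^sub>R w \<omega>"] L2_integrable_scaleR[OF assms] by (simp add: mult.commute)

text \<open>The weak identity determines the operator, and the Bochner integral, whose integrand is
  dominated by a multiple of \<open>norm (w \<omega>) * norm (z \<omega>)\<close>, satisfies it. The
  explicit formula also opens the way to dominated convergence.\<close>

lemma cov_eq_integral:
  fixes w :: "'a \<Rightarrow> 'c::{real_inner, banach, second_countable_topology}"
    and z :: "'a \<Rightarrow> 'b::{real_inner, banach, second_countable_topology}"
  assumes "w \<in> L2 M" "z \<in> L2 M"
  shows "cov M w z = (\<lambda>e. \<integral>\<omega>. (e \<bullet> z \<omega>) *\<^sub>R w \<omega> \<partial>M)" (is "_ = ?C")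
    and "bounded_linear (cov M w z)"
    and "cov M w z e \<bullet> f = (\<integral>\<omega>. (w \<omega> \<bullet> f) * (e \<bullet> z \<omega>) \<partial>M)"
proof -
  note int = L2_integrable_scaleR[OF assms]
  have inner: "?C e \<bullet> f = (\<integral>\<omega>. (w \<omega> \<bullet> f) * (e \<bullet> z \<omega>) \<partial>M)" for e f
    using integral_inner_left[of f M "\<lambda>\<omega>. (e \<bullet> z \<omega>) *\<^sub>R w \<omega>"] int by (simp add: mult.commute)
  have bl: "bounded_linear ?C"
  proof (rule bounded_linear_intro)
    show "?C (a + b) = ?C a + ?C b" for a b
      using int by (simp add: inner_add_left scaleR_left_distrib)
    show "?C (k *\<^sub>R a) = k *\<^sub>R ?C a" for k a
      by (simp add: scaleR_scaleR[symmetric] del: scaleR_scaleR)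
    show "norm (?C a) \<le> norm a * (\<integral>\<omega>. norm (w \<omega>) * norm (z \<omega>) \<partial>M)" for a
    proof -
      have "norm (?C a) \<le> (\<integral>\<omega>. norm a * (norm (w \<omega>) * norm (z \<omega>)) \<partial>M)"
      proof (rule order_trans[OF integral_norm_bound], rule integral_mono)
        show "integrable M (\<lambda>\<omega>. norm ((a \<bullet> z \<omega>) *\<^sub>R w \<omega>))" by (rule integrable_norm[OF int])
        show "integrable M (\<lambda>\<omega>. norm a * (norm (w \<omega>) * norm (z \<omega>)))"
          using L2_integrable_mult_norm[OF assms] by simp
        fix \<omega>
        have "\<bar>a \<bullet> z \<omega>\<bar> * norm (w \<omega>) \<le> (norm a * norm (z \<omega>)) * norm (w \<omega>)"
          by (intro mult_right_mono Cauchy_Schwarz_ineq2) simp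
        then show "norm ((a \<bullet> z \<omega>) *\<^sub>R w \<omega>) \<le> norm a * (norm (w \<omega>) * norm (z \<omega>))"
          by (simp add: mult_ac)
      qed
      then show ?thesis by simp
    qed
  qed
  show eq: "cov M w z = ?C"
    unfolding cov_def
  proof (rule the_equality)
    fix C assume C: "bounded_linear C \<and> (\<forall>e f. C e \<bullet> f = (\<integral>\<omega>. (w \<omega> \<bullet> f) * (e \<bullet> z \<omega>) \<partial>M))"
    show "C = ?C"
    proof
      fix e show "C e = ?C e" using C inner by (metis vector_eq_rdot)
    qed
  qed (use bl inner in blast)
  show "bounded_linear (cov M w z)" "cov M w z e \<bullet> f = (\<integral>\<omega>. (w \<omega> \<bullet> f) * (e \<bullet> z \<omega>) \<partial>M)"
    unfolding eq using bl inner by auto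
qed

lemma positive_selfadjoint_cov:
  assumes "z \<in> L2 M"
  shows "positive_selfadjoint (cov M z z)"
  unfolding positive_selfadjoint_def
proof (intro conjI allI)
  show "bounded_linear (cov M z z)" using cov_eq_integral[OF assms assms] by blast
  show "cov M z z u \<bullet> v = u \<bullet> cov M z z v" for u v
    unfolding inner_commute[of u] cov_eq_integral(3)[OF assms assms]
    by (simp add: inner_commute mult.commute)
  show "0 \<le> cov M z z u \<bullet> u" for u
    unfolding cov_eq_integral(3)[OF assms assms]
    by (intro integral_nonneg_AE) (simp add: inner_commute)
qed

text \<open>Pointwise, a weakly convergent sequence turns the integrand of the covariance into a
  convergent one, so that dominated convergence replaces any appeal to a limit vector.\<close>

lemma compact_map_cov:
  fixes z :: "'a \<Rightarrow> 'b::{real_inner, banach, second_countable_topology}"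
  assumes z: "z \<in> L2 M"
  shows "compact_map (cov M z z)"
  unfolding compact_map_def
proof (intro allI impI)
  fix u :: "nat \<Rightarrow> 'b" assume "bounded (range u)"
  then obtain K where K: "\<And>n. norm (u n) \<le> K" by (auto simp: bounded_pos)
  obtain r where r: "strict_mono (r :: nat \<Rightarrow> nat)" "\<And>v. convergent (\<lambda>n. u (r n) \<bullet> v)"
    using weakly_convergent_subsequence[OF \<open>bounded (range u)\<close>] by blast
  define g where "g v = lim (\<lambda>n. u (r n) \<bullet> v)" for v
  have g: "(\<lambda>n. u (r n) \<bullet> v) \<longlonglongrightarrow> g v" for v
    unfolding g_def using r(2) by (simp add: convergent_LIMSEQ_iff)
  have z_meas [measurable]: "z \<in> borel_measurable M" using z by (rule L2_measurable)
  have "(\<lambda>n. \<integral>\<omega>. (u (r n) \<bullet> z \<omega>) *\<^sub>R z \<omega> \<partial>M) \<longlonglongrightarrow> (\<integral>\<omega>. g (z \<omega>) *\<^sub>R z \<omega> \<partial>M)"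
  proof (rule integral_dominated_convergence)
    show "(\<lambda>\<omega>. (u (r n) \<bullet> z \<omega>) *\<^sub>R z \<omega>) \<in> borel_measurable M" for n by measurable
    show "(\<lambda>\<omega>. g (z \<omega>) *\<^sub>R z \<omega>) \<in> borel_measurable M"
      by (rule borel_measurable_LIMSEQ_metric[where f = "\<lambda>n \<omega>. (u (r n) \<bullet> z \<omega>) *\<^sub>R z \<omega>"])
        (auto intro!: tendsto_scaleR g)
    show "integrable M (\<lambda>\<omega>. K * (norm (z \<omega>) * norm (z \<omega>)))"
      using L2_integrable_mult_norm[OF z z] by simp
    show "AE \<omega> in M. (\<lambda>n. (u (r n) \<bullet> z \<omega>) *\<^sub>R z \<omega>) \<longlonglongrightarrow> g (z \<omega>) *\<^sub>R z \<omega>"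
      by (intro always_eventually allI tendsto_scaleR g tendsto_const)
    show "AE \<omega> in M. norm ((u (r n) \<bullet> z \<omega>) *\<^sub>R z \<omega>) \<le> K * (norm (z \<omega>) * norm (z \<omega>))" for n
    proof (intro always_eventually allI)
      fix \<omega>
      have "\<bar>u (r n) \<bullet> z \<omega>\<bar> \<le> norm (u (r n)) * norm (z \<omega>)" by (rule Cauchy_Schwarz_ineq2)
      also have "\<dots> \<le> K * norm (z \<omega>)" using K by (intro mult_right_mono) auto
      finally have "\<bar>u (r n) \<bullet> z \<omega>\<bar> * norm (z \<omega>) \<le> (K * norm (z \<omega>)) * norm (z \<omega>)"
        by (intro mult_right_mono) auto
      then show "norm ((u (r n) \<bullet> z \<omega>) *\<^sub>R z \<omega>) \<le> K * (norm (z \<omega>) * norm (z \<omega>))"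
        by (simp add: mult_ac)
    qed
  qed
  then show "\<exists>r. strict_mono (r :: nat \<Rightarrow> nat) \<and> convergent (\<lambda>n. cov M z z (u (r n)))"
    using r(1) by (auto simp: cov_eq_integral(1)[OF z z] convergent_def)
qed

subsection \<open>Riesz representation, square roots and finite-rank operators\<close>

lemma quadratic_nonneg_imp_linear_zero:
  fixes a c :: real
  assumes "\<And>t. 0 \<le> 2 * t * a + t\<^sup>2 * c" "0 \<le> c"
  shows "a = 0"
proof -
  \<comment> \<open>The test point is \<open>t = - q\<close>; with \<open>c + 1\<close> in place of
    \<open>c\<close> the denominator stays positive when \<open>c = 0\<close>.\<close>
  define q where "q = a / (c + 1)"
  have a: "a = q * (c + 1)" using assms(2) by (simp add: q_def)
  have "0 \<le> 2 * (- q) * a + (- q)\<^sup>2 * c" by (rule assms(1))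
  then have "q\<^sup>2 * (c + 2) \<le> 0" by (simp add: a power2_eq_square algebra_simps)
  then show ?thesis using assms(2) by (simp add: mult_le_0_iff a)
qed

text \<open>The representing vector minimises \<open>J\<close>, the squared norm minus twice the
  functional. The parallelogram law makes a minimising sequence Cauchy, and the first-order
  condition at the limit is the claim.\<close>

theorem Riesz_representation:
  fixes \<phi> :: "'b::{real_inner, banach} \<Rightarrow> real"
  assumes "bounded_linear \<phi>"
  shows "\<exists>b. \<forall>u. \<phi> u = u \<bullet> b"
proof -
  interpret bounded_linear \<phi> by fact
  obtain K where K: "\<And>u. norm (\<phi> u) \<le> norm u * K" "K \<ge> 0" using nonneg_bounded by blast
  define J where "J u = u \<bullet> u - 2 * \<phi> u" for u
  have J_lower: "- (K\<^sup>2) \<le> J u" for u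
  proof -
    have "\<phi> u \<le> norm u * K" using K(1)[of u] by simp
    moreover have "0 \<le> (norm u - K)\<^sup>2" by simp
    ultimately show ?thesis unfolding J_def power2_norm_eq_inner[symmetric] power2_diff by linarith
  qed
  define m where "m = Inf (range J)"
  have bdd: "bdd_below (range J)" using J_lower by (auto simp: bdd_below_def)
  have m_le: "m \<le> J u" for u unfolding m_def using bdd by (intro cInf_lower) auto
  have "\<exists>u. J u < m + inverse (real (Suc n))" for n
  proof -
    have "Inf (range J) < m + inverse (real (Suc n))" by (simp add: m_def)
    then show ?thesis using cInf_less_iff[of "range J"] bdd by auto
  qed
  then obtain u where u: "\<And>n. J (u n) < m + inverse (real (Suc n))" by metis
  have J_lim: "(\<lambda>n. J (u n)) \<longlonglongrightarrow> m"
  proof (rule tendsto_sandwich[OF _ _ tendsto_const])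
    show "(\<lambda>n. m + inverse (real (Suc n))) \<longlonglongrightarrow> m"
      using tendsto_add[OF tendsto_const LIMSEQ_inverse_real_of_nat, of m] by simp
  qed (use m_le less_imp_le[OF u] in \<open>auto intro!: always_eventually\<close>)
  \<comment> \<open>The parallelogram law, with \<open>J\<close> in place of the squared norm: the
    linear parts cancel because \<open>c\<close> is the midpoint.\<close>
  have par: "(norm (v - w))\<^sup>2 \<le> 2 * J v + 2 * J w - 4 * m" for v w
  proof -
    define c where "c = (1/2) *\<^sub>R (v + w)"
    have "(norm (v - w))\<^sup>2 = 2 * J v + 2 * J w - 4 * J c"
      unfolding c_def J_def power2_norm_eq_inner
      by (simp add: add scaleR inner_diff_left inner_diff_right inner_add_left inner_add_right
          inner_commute algebra_simps)
    then show ?thesis using m_le[of c] by simp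
  qed
  have "Cauchy u"
    unfolding Cauchy_iff
  proof (intro allI impI)
    fix c :: real assume "0 < c"
    then have "0 < c\<^sup>2 / 4" by simp
    then obtain N where N: "\<And>n. n \<ge> N \<Longrightarrow> norm (J (u n) - m) < c\<^sup>2 / 4"
      using J_lim unfolding LIMSEQ_iff by meson
    have "norm (u k - u n) < c" if "k \<ge> N" "n \<ge> N" for k n
    proof -
      have "(norm (u k - u n))\<^sup>2 < c\<^sup>2"
        using par[of "u k" "u n"] N[OF that(1)] N[OF that(2)] unfolding real_norm_def by linarith
      then show ?thesis using \<open>0 < c\<close> by (simp add: power2_less_imp_less)
    qed
    then show "\<exists>N. \<forall>k\<ge>N. \<forall>n\<ge>N. norm (u k - u n) < c" by blast
  qed
  then obtain b where b: "u \<longlonglongrightarrow> b" using Cauchy_convergent_iff convergent_def by blast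
  have "(\<lambda>n. J (u n)) \<longlonglongrightarrow> J b"
    unfolding J_def by (intro tendsto_intros tendsto b)
  then have Jb: "J b = m" using J_lim LIMSEQ_unique by blast
  have "\<phi> v = v \<bullet> b" for v
  proof -
    have "b \<bullet> v - \<phi> v = 0"
    proof (rule quadratic_nonneg_imp_linear_zero)
      fix t
      have "J (b + t *\<^sub>R v) = J b + (2 * t * (b \<bullet> v - \<phi> v) + t\<^sup>2 * (v \<bullet> v))"
        by (simp add: J_def add scaleR inner_add_left inner_add_right inner_commute
            power2_eq_square algebra_simps)
      with m_le[of "b + t *\<^sub>R v"] Jb show "0 \<le> 2 * t * (b \<bullet> v - \<phi> v) + t\<^sup>2 * (v \<bullet> v)" by linarith
    qed simp
    then show ?thesis by (simp add: inner_commute)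
  qed
  then show ?thesis by blast
qed

lemma orthonormal_expansion:
  fixes e :: "nat \<Rightarrow> 'b::{real_inner, banach}" and L :: "'b \<Rightarrow> 'c::real_normed_vector"
  assumes e: "orthonormal_or_zero e" and L: "bounded_linear L"
    and ker: "\<And>u. (\<And>n. u \<bullet> e n = 0) \<Longrightarrow> L u = 0"
  shows "(\<lambda>i. (h \<bullet> e i) *\<^sub>R L (e i)) sums L h"
proof -
  interpret bounded_linear L by fact
  have "L (h - fourier_proj e h) = 0" by (rule ker) (rule fourier_proj_orthogonal[OF e])
  then have "L (fourier_proj e h) = L h" by (simp add: diff)
  then show ?thesis using sums[OF fourier_proj_sums[OF e, of h]] by (simp add: scaleR)
qed

section \<open>Existence and uniqueness of the positive square root\<close>

lemma eigen_systemD: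
  assumes "eigen_system V B e l"
  shows "orthonormal_or_zero e" "e n \<in> V" "decseq l" "0 \<le> l n" "l \<longlonglongrightarrow> 0" "e n = 0 \<longleftrightarrow> l n = 0"
    "B (e n) = l n *\<^sub>R e n" "\<And>u. u \<in> V \<Longrightarrow> (\<And>n. u \<bullet> e n = 0) \<Longrightarrow> B u = 0"
  using assms unfolding eigen_system_def by blast+

text \<open>Since \<open>B - l n\<close> factors as \<open>(S + sqrt (l n))\<close> times
  \<open>(S - sqrt (l n))\<close>, the vector \<open>v\<close> is annihilated by the first factor,
  which positivity of \<open>S\<close> makes injective when \<open>l n > 0\<close>. All positive
  roots therefore act alike on the eigenvectors, which is the core of uniqueness.\<close>

lemma sqrt_on_eigen_system:
  fixes B :: "'b::{real_inner, banach} \<Rightarrow> 'b"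
  assumes es: "eigen_system UNIV B e l" and S: "positive_selfadjoint S" "S \<circ> S = B"
  shows "S (e n) = sqrt (l n) *\<^sub>R e n" and "(\<And>n. u \<bullet> e n = 0) \<Longrightarrow> S u = 0"
proof -
  interpret bounded_linear S using S by (simp add: positive_selfadjoint_def)
  have sym: "S a \<bullet> b = a \<bullet> S b" and pos: "0 \<le> S a \<bullet> a" for a b
    using S by (auto simp: positive_selfadjoint_def)
  have SS: "S (S a) = B a" for a using S(2) by (metis comp_apply)
  show "S (e n) = sqrt (l n) *\<^sub>R e n"
  proof (cases "l n = 0")
    case True
    then show ?thesis using eigen_systemD(6)[OF es, of n] by (simp add: zero)
  next
    case False
    then have lp: "l n > 0" using eigen_systemD(4)[OF es, of n] by simp
    define v where "v = S (e n) - sqrt (l n) *\<^sub>R e n"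
    have "S v + sqrt (l n) *\<^sub>R v = 0"
      using lp by (simp add: v_def diff scaleR SS eigen_systemD(7)[OF es] scaleR_diff_right)
    then have "S v \<bullet> v + sqrt (l n) * (v \<bullet> v) = 0"
      by (metis inner_add_left inner_scaleR_left inner_zero_left)
    moreover have "0 \<le> sqrt (l n) * (v \<bullet> v)" using lp by simp
    ultimately have "sqrt (l n) * (v \<bullet> v) = 0" using pos[of v] by linarith
    then show ?thesis using lp by (simp add: v_def)
  qed
  show "S u = 0" if "\<And>n. u \<bullet> e n = 0"
  proof -
    have "B u = 0" using eigen_systemD(8)[OF es] that by blast
    then have "S u \<bullet> S u = 0" by (simp add: sym SS)
    then show ?thesis by simp
  qed
qed

lemma op_sqrt_eigen_system:
  fixes B :: "'b::{real_inner, banach} \<Rightarrow> 'b"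
  assumes B: "positive_selfadjoint B" and es: "eigen_system UNIV B e l"
  shows "positive_selfadjoint (op_sqrt B)" "op_sqrt B \<circ> op_sqrt B = B"
proof -
  interpret bounded_linear B using B by (simp add: positive_selfadjoint_def)
  note e = eigen_systemD(1)[OF es]
  define c where "c u i = sqrt (l i) * (u \<bullet> e i)" for u i
  define S where "S u = (\<Sum>i. c u i *\<^sub>R e i)" for u
  have c0: "c u i = 0" if "e i = 0" for u i using that by (simp add: c_def)
  have c_le: "(c u i)\<^sup>2 \<le> l 0 * (u \<bullet> e i)\<^sup>2" for u i
    using eigen_systemD(4)[OF es, of i] decseqD[OF eigen_systemD(3)[OF es], of 0 i]
    by (simp add: c_def power_mult_distrib mult_right_mono)
  have c_sum: "summable (\<lambda>i. (c u i)\<^sup>2)" for u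
    by (rule summable_comparison_test'[OF summable_mult[OF bessel_summable[OF e]]])
      (use c_le in auto)
  have S_sums: "(\<lambda>i. c u i *\<^sub>R e i) sums S u" for u
    unfolding S_def by (intro summable_sums summable_orthonormal e c_sum)
  have S_e: "S u \<bullet> e j = c u j" for u j
    unfolding S_def by (intro suminf_orthonormal_inner e c_sum c0)
  have S_inner: "(\<lambda>i. sqrt (l i) * (u \<bullet> e i) * (v \<bullet> e i)) sums (S u \<bullet> v)" for u v
    using bounded_linear.sums[OF bounded_linear_inner_left[of v] S_sums[of u]]
    by (simp add: c_def inner_commute[of v])
  have bl: "bounded_linear S"
  proof (rule bounded_linear_intro)
    show "S (a + b) = S a + S b" for a b
      using sums_add[OF S_sums[of a] S_sums[of b]] S_sums[of "a + b"] sums_unique2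
      by (fastforce simp: c_def inner_add_left algebra_simps)
    show "S (k *\<^sub>R a) = k *\<^sub>R S a" for k a
      using bounded_linear.sums[OF bounded_linear_scaleR_right[of k] S_sums[of a]]
        S_sums[of "k *\<^sub>R a"] sums_unique2
      by (fastforce simp: c_def mult_ac)
    show "norm (S a) \<le> norm a * sqrt (l 0)" for a
    proof (rule LIMSEQ_le_const2)
      show "(\<lambda>N. norm (\<Sum>i<N. c a i *\<^sub>R e i)) \<longlonglongrightarrow> norm (S a)"
        using S_sums unfolding sums_def by (intro tendsto_norm)
      have "norm (\<Sum>i<N. c a i *\<^sub>R e i) \<le> norm a * sqrt (l 0)" for N
      proof (rule power2_le_imp_le)
        have "(norm (\<Sum>i<N. c a i *\<^sub>R e i))\<^sup>2 \<le> (\<Sum>i<N. (c a i)\<^sup>2)"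
          by (subst norm_sum_orthonormal[OF e]) (auto intro!: sum_mono)
        also have "\<dots> \<le> l 0 * (\<Sum>i<N. (a \<bullet> e i)\<^sup>2)"
          unfolding sum_distrib_left by (intro sum_mono c_le)
        also have "\<dots> \<le> l 0 * (norm a)\<^sup>2"
          by (intro mult_left_mono bessel_finite e eigen_systemD(4)[OF es]) simp
        finally show "(norm (\<Sum>i<N. c a i *\<^sub>R e i))\<^sup>2 \<le> (norm a * sqrt (l 0))\<^sup>2"
          using eigen_systemD(4)[OF es, of 0] by (simp add: power_mult_distrib mult.commute)
      qed (simp add: eigen_systemD(4)[OF es])
      then show "\<exists>N. \<forall>n\<ge>N. norm (\<Sum>i<n. c a i *\<^sub>R e i) \<le> norm a * sqrt (l 0)" by blast
    qed
  qed
  have S_sym: "S u \<bullet> v = u \<bullet> S v" for u v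
  proof -
    have "(\<lambda>i. sqrt (l i) * (u \<bullet> e i) * (v \<bullet> e i)) = (\<lambda>i. sqrt (l i) * (v \<bullet> e i) * (u \<bullet> e i))"
      by (simp add: mult_ac)
    then have "S u \<bullet> v = S v \<bullet> u" using S_inner[of u v] S_inner[of v u] by (metis sums_unique2)
    then show ?thesis by (simp add: inner_commute)
  qed
  have S_pos: "0 \<le> S u \<bullet> u" for u
    using eigen_systemD(4)[OF es]
    by (intro sums_le[OF _ sums_zero S_inner[of u u]]) (simp add: mult.assoc)
  have ps: "positive_selfadjoint S"
    unfolding positive_selfadjoint_def using bl S_sym S_pos by blast
  have SS: "S \<circ> S = B"
  proof
    fix u
    have "(\<lambda>i. (u \<bullet> e i) *\<^sub>R B (e i)) sums B u"
      using eigen_systemD(8)[OF es] by (intro orthonormal_expansion e bounded_linear_axioms) blast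
    moreover have "(u \<bullet> e i) *\<^sub>R B (e i) = c (S u) i *\<^sub>R e i" for i
    proof -
      have "c (S u) i = l i * (u \<bullet> e i)"
        unfolding c_def[of "S u"] S_e unfolding c_def[of u] mult.assoc[symmetric]
        using eigen_systemD(4)[OF es, of i] by simp
      then show ?thesis unfolding eigen_systemD(7)[OF es] by (simp add: mult.commute)
    qed
    ultimately show "(S \<circ> S) u = B u" using S_sums[of "S u"] sums_unique2 by (fastforce simp: comp_def)
  qed
  have uniq: "S' = S" if "positive_selfadjoint S' \<and> S' \<circ> S' = B" for S'
  proof
    fix u
    have bl': "bounded_linear S'" using that by (simp add: positive_selfadjoint_def)
    note S' = sqrt_on_eigen_system[OF es, of S'] and S = sqrt_on_eigen_system[OF es ps SS]
    have "(\<lambda>i. (u \<bullet> e i) *\<^sub>R S' (e i)) sums S' u" using that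
      by (intro orthonormal_expansion e bl') (use S' in blast)
    moreover have "(\<lambda>i. (u \<bullet> e i) *\<^sub>R S (e i)) sums S u"
      by (intro orthonormal_expansion e bl) (use S in blast)
    ultimately show "S' u = S u" using that by (simp add: S' S sums_unique2)
  qed
  have "op_sqrt B = S"
    unfolding op_sqrt_def by (rule the_equality) (use ps SS uniq in blast)+
  then show "positive_selfadjoint (op_sqrt B)" "op_sqrt B \<circ> op_sqrt B = B" using ps SS by auto
qed

section \<open>Orthogonal projections and the Moore--Penrose inverse\<close>

lemma subspace_inner_eq_0:
  assumes "p \<in> V" "p \<in> orthogonal_comp V"
  shows "p = 0"
  using assms unfolding orthogonal_comp_def orthogonal_def by auto

lemma orth_proj_eqI:
  assumes "subspace V" "p \<in> V" "u - p \<in> orthogonal_comp V"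
  shows "orth_proj V u = p"
  unfolding orth_proj_def
proof (rule the_equality)
  fix q assume q: "q \<in> V \<and> u - q \<in> orthogonal_comp V"
  have "q - p \<in> V" using assms q by (simp add: subspace_diff)
  moreover have "(u - p) - (u - q) \<in> orthogonal_comp V"
    using assms q subspace_orthogonal_comp by (blast intro: subspace_diff)
  ultimately show "q = p" using subspace_inner_eq_0[of "q - p" V] by simp
qed (use assms in blast)

text \<open>Every evaluation of the Moore--Penrose inverse rests on this: it suffices to exhibit a
  preimage orthogonal to the kernel, where \<open>S\<close> is injective.\<close>

lemma mp_inv_eqI:
  assumes S: "linear S" and w: "w \<in> orthogonal_comp (ker S)"
  shows "mp_inv S (S w) = w"
proof -
  have "subspace (range S)" using S by (simp add: linear_subspace_image)
  have dom: "S w \<in> mp_dom S"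
    unfolding mp_dom_def using subspace_orthogonal_comp[of "range S"] subspace_0
    by (force intro: exI[of _ "S w"] exI[of _ 0])
  have the: "(THE h. h \<in> range S \<and> S w - h \<in> orthogonal_comp (range S)) = S w"
    using orth_proj_eqI[OF \<open>subspace (range S)\<close>, of "S w" "S w"] subspace_orthogonal_comp[of "range S"]
    by (simp add: orth_proj_def subspace_0)
  have "inj_on S (orthogonal_comp (ker S))"
  proof (rule inj_onI)
    fix a b assume ab: "a \<in> orthogonal_comp (ker S)" "b \<in> orthogonal_comp (ker S)" "S a = S b"
    then have "a - b \<in> ker S" using S by (simp add: ker_def linear_diff)
    moreover have "a - b \<in> orthogonal_comp (ker S)"
      using ab by (simp add: subspace_diff subspace_orthogonal_comp)
    ultimately show "a = b" using subspace_inner_eq_0 by fastforce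
  qed
  then show ?thesis unfolding mp_inv_def the using dom w by (simp add: inv_into_f_f)
qed

section \<open>Operators of finite rank\<close>

definition finite_rank_op ::
  "nat \<Rightarrow> (nat \<Rightarrow> 'c) \<Rightarrow> (nat \<Rightarrow> 'b) \<Rightarrow> 'b::real_inner \<Rightarrow> 'c::real_vector" where
  "finite_rank_op r a b u = (\<Sum>j<r. (u \<bullet> b j) *\<^sub>R a j)"

lemma bounded_linear_finite_rank_op:
  fixes a :: "nat \<Rightarrow> 'c::real_normed_vector"
  shows "bounded_linear (finite_rank_op r a b)"
  unfolding finite_rank_op_def [abs_def]
  by (intro bounded_linear_sum bounded_linear_scaleR_const bounded_linear_inner_left)

lemma adjoint_finite_rank_op:
  fixes a :: "nat \<Rightarrow> 'c::real_inner"
  shows "adjoint (finite_rank_op r a b) = finite_rank_op r b a"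
  by (rule adjoint_unique)
    (simp add: finite_rank_op_def inner_sum_left inner_sum_right inner_commute mult_ac)

lemma finite_rank_op_B00:
  fixes a :: "nat \<Rightarrow> 'c::real_normed_vector"
  shows "finite_rank_op r a b \<in> B00 r"
proof -
  let ?A = "finite_rank_op r a b"
  obtain B where B: "B \<subseteq> range ?A" "independent B" "range ?A \<subseteq> span B"
    by (rule maximal_independent_subset)
  have "range ?A \<subseteq> span (a ` {..<r})"
    unfolding finite_rank_op_def by (auto intro: span_sum span_scale span_base)
  then have "finite B \<and> card B \<le> card (a ` {..<r})"
    using B by (intro independent_span_bound) auto
  moreover have "card (a ` {..<r}) \<le> r" using card_image_le[of "{..<r}" a] by simp
  moreover have "subspace (range ?A)"
    using bounded_linear_finite_rank_op by (intro linear_subspace_image bounded_linear.linear) auto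
  then have "span B = range ?A" using B by (simp add: span_subspace)
  ultimately show ?thesis
    unfolding B00_def using bounded_linear_finite_rank_op B(2) by fastforce
qed

text \<open>An orthonormal basis of the range, padded with zeros, gives \<open>a\<close>; the
  coordinates \<open>A u \<bullet> a j\<close> are bounded functionals of \<open>u\<close>, so Riesz
  representation gives \<open>b\<close>.\<close>

lemma B00_eq_finite_rank_op:
  fixes A :: "'b::{real_inner, banach} \<Rightarrow> 'c::real_inner"
  assumes "A \<in> B00 r"
  shows "\<exists>a b. orthonormal_or_zero a \<and> (\<forall>j. a j = 0 \<longrightarrow> b j = 0) \<and> A = finite_rank_op r a b"
proof -
  obtain B where A: "bounded_linear A" and B: "finite B" "card B \<le> r" "span B = range A"
    using assms unfolding B00_def by blast
  obtain C where C: "finite C" "card C \<le> card B" "span C = span B" "pairwise orthogonal C"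
    using basis_orthogonal[OF B(1)] by blast
  obtain h where h: "bij_betw h {0..<card C} C" using ex_bij_betw_nat_finite[OF C(1)] by blast
  have orth: "h i \<bullet> h j = 0" if "i < card C" "j < card C" "i \<noteq> j" for i j
  proof -
    have "h i \<in> C" "h j \<in> C" "h i \<noteq> h j"
      using h that by (auto simp: bij_betw_def inj_on_eq_iff)
    then show ?thesis using C(4) by (auto simp: pairwise_def orthogonal_def)
  qed
  \<comment> \<open>A zero vector in \<open>C\<close> would stay zero under this normalisation,
    which \<open>orthonormal_or_zero\<close> permits.\<close>
  define a where "a j = (if j < card C then (1 / norm (h j)) *\<^sub>R h j else 0)" for j
  have a: "orthonormal_or_zero a"
    unfolding orthonormal_or_zero_def
    by (auto simp: a_def orth dot_square_norm power2_eq_square)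
  define W where "W = {w. w = (\<Sum>j<r. (w \<bullet> a j) *\<^sub>R a j)}"
  have "subspace W"
    unfolding subspace_def W_def
    by (auto simp: inner_add_left scaleR_left_distrib sum.distrib scaleR_sum_right)
      (metis (no_types, lifting) scaleR_sum_right scaleR_scaleR sum.cong)
  moreover have "C \<subseteq> W"
  proof
    fix w assume "w \<in> C"
    then obtain k where k: "k < card C" "w = h k" using h by (force simp: bij_betw_def)
    have "(\<Sum>j<r. (w \<bullet> a j) *\<^sub>R a j) = (\<Sum>j<r. if j = k then w else 0)"
      using k by (intro sum.cong) (auto simp: a_def orth dot_square_norm power2_eq_square)
    also have "\<dots> = w" using k C(2) B(2) by simp
    finally show "w \<in> W" by (simp add: W_def)
  qed
  ultimately have span: "range A \<subseteq> W" using span_minimal[of C W] C(3) B(3) by simp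
  have "\<exists>b. \<forall>u. A u \<bullet> a j = u \<bullet> b" for j
    using Riesz_representation[OF bounded_linear_compose[OF bounded_linear_inner_left A]] by simp
  then obtain b where b: "\<And>j u. A u \<bullet> a j = u \<bullet> b j" by metis
  have "b j = 0" if "a j = 0" for j using b[of "b j" j] that by simp
  moreover have "A u = finite_rank_op r a b u" for u
    using span unfolding W_def finite_rank_op_def b[symmetric] by blast
  ultimately show ?thesis using a by blast
qed

subsection \<open>Singular value decompositions and optimal families\<close>

text \<open>A normal form of \<open>is_svd\<close>: the vectors that it leaves free at zero singular
  values are set to 0. No term of the series changes, so the truncations are the same
  operators.\<close>

definition svd_system ::
  "('b::real_inner \<Rightarrow> 'c::real_inner) \<Rightarrow> (nat \<Rightarrow> real) \<Rightarrow> (nat \<Rightarrow> 'b) \<Rightarrow> (nat \<Rightarrow> 'c) \<Rightarrow> bool" where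
  "svd_system T s e f \<longleftrightarrow>
     decseq s \<and> (\<forall>i. 0 \<le> s i) \<and> s \<longlonglongrightarrow> 0 \<and> orthonormal_or_zero e \<and> orthonormal_or_zero f \<and>
     (\<forall>i. e i = 0 \<longleftrightarrow> s i = 0) \<and> (\<forall>i. f i = 0 \<longleftrightarrow> s i = 0) \<and>
     (\<forall>h. (\<lambda>i. (s i * (h \<bullet> e i)) *\<^sub>R f i) sums T h)"

lemma svd_systemD:
  assumes "svd_system T s e f"
  shows "decseq s" "0 \<le> s i" "s \<longlonglongrightarrow> 0" "orthonormal_or_zero e" "orthonormal_or_zero f"
    "e i = 0 \<longleftrightarrow> s i = 0" "f i = 0 \<longleftrightarrow> s i = 0" "(\<lambda>i. (s i * (h \<bullet> e i)) *\<^sub>R f i) sums T h"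
  using assms unfolding svd_system_def by blast+

lemma orthonormal_on_nonzero: "orthonormal_on {i. s i > 0} e \<Longrightarrow> 0 < (s i :: real) \<Longrightarrow> e i \<noteq> 0"
  unfolding orthonormal_on_def by (metis inner_zero_left mem_Collect_eq zero_neq_one)

lemma orthonormal_or_zero_restrict:
  assumes "orthonormal_on {i. s i > 0} e"
  shows "orthonormal_or_zero (\<lambda>i. if 0 < (s i :: real) then e i else 0)"
proof -
  have "e i \<bullet> e j = (if i = j then 1 else 0)" if "0 < s i" "0 < s j" for i j
    using assms that unfolding orthonormal_on_def by blast
  then show ?thesis
    using orthonormal_on_nonzero[OF assms] unfolding orthonormal_or_zero_def by (metis inner_zero_left inner_zero_right)
qed

lemma is_truncated_svd_iff:
  "is_truncated_svd r T U \<longleftrightarrow>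
     (\<exists>s e f. svd_system T s e f \<and> U = finite_rank_op r (\<lambda>i. s i *\<^sub>R f i) e)" (is "?L \<longleftrightarrow> ?R")
proof
  assume ?L
  then obtain s e f where svd: "is_svd T s e f"
    and U: "U = (\<lambda>h. \<Sum>i<r. (s i * (h \<bullet> e i)) *\<^sub>R f i)"
    unfolding is_truncated_svd_def by blast
  define e' f' where "e' i = (if 0 < s i then e i else 0)" and "f' i = (if 0 < s i then f i else 0)" for i
  have s0: "0 \<le> s i" for i using svd by (simp add: is_svd_def)
  have s0': "0 < s i \<longleftrightarrow> s i \<noteq> 0" for i using s0[of i] by auto
  have eq: "(s i * (h \<bullet> e' i)) *\<^sub>R f' i = (s i * (h \<bullet> e i)) *\<^sub>R f i" for h i
    using s0[of i] by (auto simp: e'_def f'_def)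
  have orth: "orthonormal_on {i. s i > 0} e" "orthonormal_on {i. s i > 0} f"
    using svd by (auto simp: is_svd_def)
  have "svd_system T s e' f'"
    unfolding svd_system_def eq
    using svd orth[THEN orthonormal_or_zero_restrict] orth[THEN orthonormal_on_nonzero]
    by (auto simp: is_svd_def e'_def[abs_def] f'_def[abs_def] s0')
  moreover have "U = finite_rank_op r (\<lambda>i. s i *\<^sub>R f' i) e'"
    unfolding U finite_rank_op_def[abs_def] eq[symmetric] by (simp add: mult.commute)
  ultimately show ?R by blast
next
  assume ?R
  then obtain s e f where svd: "svd_system T s e f" and U: "U = finite_rank_op r (\<lambda>i. s i *\<^sub>R f i) e"
    by blast
  have "orthonormal_on {i. s i > 0} e" "orthonormal_on {i. s i > 0} f"
    unfolding orthonormal_on_def orthonormal_or_zeroD[OF svd_systemD(4)[OF svd]]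
      orthonormal_or_zeroD[OF svd_systemD(5)[OF svd]] svd_systemD(6)[OF svd] svd_systemD(7)[OF svd]
    by auto
  then have "is_svd T s e f" using svd by (simp add: is_svd_def svd_system_def)
  moreover have "U = (\<lambda>h. \<Sum>i<r. (s i * (h \<bullet> e i)) *\<^sub>R f i)"
    unfolding U finite_rank_op_def[abs_def] by (simp add: mult.commute)
  ultimately show ?L unfolding is_truncated_svd_def by blast
qed

lemma svd_system_apply:
  assumes "svd_system T s e f"
  shows "T (e i) = s i *\<^sub>R f i"
proof -
  have "(\<lambda>k. (s k * (e i \<bullet> e k)) *\<^sub>R f k) = (\<lambda>k. if k = i then s i *\<^sub>R f i else 0)"
    using svd_systemD(6)[OF assms] by (auto simp: orthonormal_or_zeroD[OF svd_systemD(4)[OF assms]])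
  then show ?thesis
    using svd_systemD(8)[OF assms, of "e i"] sums_single[of i "\<lambda>_. s i *\<^sub>R f i"] sums_unique2 by metis
qed

section \<open>Ky Fan's inequality\<close>

lemma svd_system_norm_sums:
  assumes "svd_system T s e f"
  shows "(\<lambda>i. (s i)\<^sup>2 * (h \<bullet> e i)\<^sup>2) sums (norm (T h))\<^sup>2"
proof -
  have "(\<lambda>N. (norm (\<Sum>i<N. (s i * (h \<bullet> e i)) *\<^sub>R f i))\<^sup>2) \<longlonglongrightarrow> (norm (T h))\<^sup>2"
    using svd_systemD(8)[OF assms] unfolding sums_def by (intro tendsto_power tendsto_norm)
  moreover have "(norm (\<Sum>i<N. (s i * (h \<bullet> e i)) *\<^sub>R f i))\<^sup>2 = (\<Sum>i<N. (s i)\<^sup>2 * (h \<bullet> e i)\<^sup>2)" for N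
    using svd_systemD(7)[OF assms]
    by (subst norm_sum_orthonormal[OF svd_systemD(5)[OF assms]])
      (auto intro!: sum.cong simp: power_mult_distrib)
  ultimately show ?thesis unfolding sums_def by simp
qed

text \<open>A total weight of at most \<open>r\<close>, with at most 1 per index, is best spent on
  the \<open>r\<close> largest values. Subtracting the threshold \<open>l r\<close> allows a
  comparison term by term, since \<open>l i - l r\<close> is nonnegative before \<open>r\<close> and
  nonpositive from \<open>r\<close> on.\<close>

lemma weighted_sum_le:
  fixes l w :: "nat \<Rightarrow> real"
  assumes "decseq l" "\<And>i. 0 \<le> l i" "\<And>i. 0 \<le> w i" "\<And>i. w i \<le> 1" "(\<Sum>i<N. w i) \<le> real r"
  shows "(\<Sum>i<N. l i * w i) \<le> (\<Sum>i<r. l i)"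
proof -
  have "(\<Sum>i<N. (l i - l r) * w i) \<le> (\<Sum>i<N. if i < r then l i - l r else 0)"
  proof (rule sum_mono)
    fix i
    show "(l i - l r) * w i \<le> (if i < r then l i - l r else 0)"
    proof (cases "i < r")
      case True
      then have "0 \<le> l i - l r" using decseqD[OF assms(1), of i r] by simp
      then show ?thesis using True mult_left_mono[OF assms(4)[of i], of "l i - l r"] by simp
    next
      case False
      then have "l i - l r \<le> 0" using decseqD[OF assms(1), of r i] by simp
      then show ?thesis using False assms(3)[of i] by (simp add: mult_nonpos_nonneg)
    qed
  qed
  also have "\<dots> = (\<Sum>i\<in>{..<N} \<inter> {..<r}. l i - l r)"
    by (simp add: sum.inter_restrict)
  also have "\<dots> \<le> (\<Sum>i<r. l i - l r)"
    using decseqD[OF assms(1)] by (intro sum_mono2) auto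
  finally have "(\<Sum>i<N. l i * w i) - l r * (\<Sum>i<N. w i) \<le> (\<Sum>i<r. l i) - real r * l r"
    by (simp add: sum_subtractf sum_distrib_left left_diff_distrib)
  moreover have "l r * (\<Sum>i<N. w i) \<le> real r * l r"
    using mult_left_mono[OF assms(5) assms(2)[of r]] by (simp add: mult.commute)
  ultimately show ?thesis by linarith
qed

lemma sum_norm_sq_orthonormal_le:
  assumes "orthonormal_or_zero a"
  shows "(\<Sum>j<r. (norm (a j))\<^sup>2) \<le> real r"
proof -
  have "(\<Sum>j<r. (norm (a j))\<^sup>2) \<le> (\<Sum>j<r. 1)"
    using orthonormal_or_zero_norm_le[OF assms] by (intro sum_mono) (simp add: power_le_one)
  then show ?thesis by simp
qed

text \<open>The sum of squared norms is a weighted sum of the squared singular values with weights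
  \<open>w i\<close>. Bessel's inequality for \<open>a\<close> bounds each weight by 1, and Bessel's
  inequality for \<open>e\<close> bounds their total by \<open>r\<close>.\<close>

lemma Ky_Fan_le:
  assumes svd: "svd_system T s e f" and a: "orthonormal_or_zero a"
  shows "(\<Sum>j<r. (norm (T (a j)))\<^sup>2) \<le> (\<Sum>i<r. (s i)\<^sup>2)"
proof (rule LIMSEQ_le_const2)
  note e = svd_systemD(4)[OF svd]
  define w where "w i = (\<Sum>j<r. (a j \<bullet> e i)\<^sup>2)" for i
  have "(\<lambda>i. \<Sum>j<r. (s i)\<^sup>2 * (a j \<bullet> e i)\<^sup>2) sums (\<Sum>j<r. (norm (T (a j)))\<^sup>2)"
    by (intro sums_sum svd_system_norm_sums[OF svd])
  then show "(\<lambda>N. \<Sum>i<N. (s i)\<^sup>2 * w i) \<longlonglongrightarrow> (\<Sum>j<r. (norm (T (a j)))\<^sup>2)"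
    by (simp add: sums_def w_def sum_distrib_left)
  have "(\<Sum>i<N. (s i)\<^sup>2 * w i) \<le> (\<Sum>i<r. (s i)\<^sup>2)" for N
  proof (rule weighted_sum_le)
    show "decseq (\<lambda>i. (s i)\<^sup>2)"
      using svd_systemD(1,2)[OF svd] by (auto simp: decseq_def intro!: power_mono)
    show "w i \<le> 1" for i
    proof -
      have "w i \<le> (norm (e i))\<^sup>2"
        unfolding w_def inner_commute[of _ "e i"] by (intro bessel_finite a) simp
      also have "\<dots> \<le> 1" using orthonormal_or_zero_norm_le[OF e] by (simp add: power_le_one)
      finally show ?thesis .
    qed
    have "(\<Sum>i<N. w i) = (\<Sum>j<r. \<Sum>i<N. (a j \<bullet> e i)\<^sup>2)" unfolding w_def by (rule sum.swap)
    also have "\<dots> \<le> (\<Sum>j<r. (norm (a j))\<^sup>2)" by (intro sum_mono bessel_finite e) simp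
    also have "\<dots> \<le> real r" by (rule sum_norm_sq_orthonormal_le[OF a])
    finally show "(\<Sum>i<N. w i) \<le> real r" .
  qed (auto simp: w_def intro: sum_nonneg)
  then show "\<exists>N. \<forall>n\<ge>N. (\<Sum>i<n. (s i)\<^sup>2 * w i) \<le> (\<Sum>i<r. (s i)\<^sup>2)" by blast
qed

lemma Ky_Fan_attained:
  assumes svd: "svd_system T s e f"
  shows "(\<Sum>j<r. (norm (T (e j)))\<^sup>2) = (\<Sum>i<r. (s i)\<^sup>2)"
proof (rule sum.cong)
  fix i
  have "s i = 0 \<or> norm (f i) = 1"
    using orthonormal_or_zeroD[OF svd_systemD(5)[OF svd], of i i] svd_systemD(7)[OF svd, of i]
    by (auto simp: norm_eq_1)
  then show "(norm (T (e i)))\<^sup>2 = (s i)\<^sup>2" by (auto simp: svd_system_apply[OF svd])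
qed simp

section \<open>Decompositions from the Gram operator, and families attaining Ky Fan's bound\<close>

lemma svd_system_of_eigen_system:
  fixes T :: "'b::{real_inner, banach} \<Rightarrow> 'c::real_inner"
  assumes T: "bounded_linear T" and BT: "\<And>h k. B h \<bullet> k = T h \<bullet> T k"
    and es: "eigen_system UNIV B e l"
  shows "svd_system T (\<lambda>i. sqrt (l i)) e (\<lambda>i. (1 / sqrt (l i)) *\<^sub>R T (e i))"
proof -
  interpret bounded_linear T by fact
  note e = eigen_systemD(1)[OF es]
  have TT: "T (e i) \<bullet> T (e j) = (if i = j \<and> l i \<noteq> 0 then l i else 0)" for i j
    using orthonormal_or_zeroD[OF e, of i j] eigen_systemD(6)[OF es, of i]
    by (auto simp: BT[symmetric] eigen_systemD(7)[OF es])
  have T0: "T (e i) = 0 \<longleftrightarrow> l i = 0" for i using TT[of i i] by (auto split: if_splits)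
  have T_sums: "(\<lambda>i. (h \<bullet> e i) *\<^sub>R T (e i)) sums T h" for h
  proof (rule orthonormal_expansion[OF e T])
    fix u assume "\<And>n. u \<bullet> e n = 0"
    then have "B u = 0" using eigen_systemD(8)[OF es] by blast
    then show "T u = 0" using BT[of u u] by simp
  qed
  have "(\<lambda>i. (sqrt (l i) * (h \<bullet> e i)) *\<^sub>R (1 / sqrt (l i)) *\<^sub>R T (e i)) sums T h" for h
  proof -
    \<comment> \<open>Where \<open>l i = 0\<close> the division by zero does no harm, because
      \<open>T (e i)\<close> is 0 as well.\<close>
    have "(sqrt (l i) * (h \<bullet> e i)) *\<^sub>R (1 / sqrt (l i)) *\<^sub>R T (e i) = (h \<bullet> e i) *\<^sub>R T (e i)" for i
      using T0[of i] by auto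
    then show ?thesis using T_sums by presburger
  qed
  moreover have "decseq (\<lambda>i. sqrt (l i))" using eigen_systemD(3)[OF es] by (auto simp: decseq_def)
  moreover have "(\<lambda>i. sqrt (l i)) \<longlonglongrightarrow> 0" using tendsto_real_sqrt[OF eigen_systemD(5)[OF es]] by simp
  moreover have "orthonormal_or_zero (\<lambda>i. (1 / sqrt (l i)) *\<^sub>R T (e i))"
    unfolding orthonormal_or_zero_def
    using eigen_systemD(4)[OF es] by (auto simp: TT T0)
  ultimately show ?thesis
    unfolding svd_system_def using e eigen_systemD(4,6)[OF es]
    by (intro conjI allI) (auto simp: T0)
qed

lemma optimal_family_replace:
  fixes T :: "'b::real_inner \<Rightarrow> 'c::real_inner"
  assumes T: "bounded_linear T" and a: "orthonormal_or_zero a"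
    and opt: "\<forall>c. orthonormal_or_zero c \<longrightarrow> (\<Sum>k<r. (norm (T (c k)))\<^sup>2) \<le> (\<Sum>k<r. (norm (T (a k)))\<^sup>2)"
    and j: "j < r" and x: "\<And>k. k < r \<Longrightarrow> k \<noteq> j \<Longrightarrow> x \<bullet> a k = 0"
  shows "(norm (T x))\<^sup>2 \<le> (norm (T (a j)))\<^sup>2 * (norm x)\<^sup>2"
proof (cases "x = 0")
  case True
  then show ?thesis using T by (simp add: bounded_linear.linear linear_0)
next
  case False
  interpret bounded_linear T by fact
  define u where "u = (1 / norm x) *\<^sub>R x"
  have u: "u \<bullet> u = 1" "\<And>k. k < r \<Longrightarrow> k \<noteq> j \<Longrightarrow> u \<bullet> a k = 0" "\<And>k. k < r \<Longrightarrow> k \<noteq> j \<Longrightarrow> a k \<bullet> u = 0"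
    using False x by (simp_all add: u_def dot_square_norm power2_eq_square inner_commute[of "a _" x])
  \<comment> \<open>Entries from \<open>r\<close> on are cleared, as \<open>u\<close> need not be
    orthogonal to them.\<close>
  define c where "c k = (if k = j then u else if k < r then a k else 0)" for k
  have "orthonormal_or_zero c"
    unfolding orthonormal_or_zero_def using u
    by (auto simp: c_def orthonormal_or_zeroD[OF a])
  then have "(\<Sum>k<r. (norm (T (c k)))\<^sup>2) \<le> (\<Sum>k<r. (norm (T (a k)))\<^sup>2)" using opt by blast
  moreover have "(\<Sum>k\<in>{..<r}-{j}. (norm (T (c k)))\<^sup>2) = (\<Sum>k\<in>{..<r}-{j}. (norm (T (a k)))\<^sup>2)"
    by (rule sum.cong) (auto simp: c_def)
  ultimately have "(norm (T (c j)))\<^sup>2 \<le> (norm (T (a j)))\<^sup>2"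
    using j by (simp add: sum.remove[of "{..<r}" j])
  then show ?thesis using False by (simp add: c_def u_def scaleR power_divide divide_le_eq)
qed

lemma eigen_system_finite_expansion:
  fixes L :: "'b::real_inner \<Rightarrow> 'c::real_vector"
  assumes es: "eigen_system W B e l" and W: "subspace W" and fin: "\<And>n. r \<le> n \<Longrightarrow> e n = 0"
    and L: "linear L" and ker: "\<And>u. B u = 0 \<Longrightarrow> L u = 0" and w: "w \<in> W"
  shows "L w = (\<Sum>n<r. (w \<bullet> e n) *\<^sub>R L (e n))"
proof -
  define p where "p = (\<Sum>n<r. (w \<bullet> e n) *\<^sub>R e n)"
  have "p \<in> W" unfolding p_def using W eigen_systemD(2)[OF es] by (intro subspace_sum subspace_scale)
  moreover have "(w - p) \<bullet> e n = 0" for n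
    using fin[of n] by (cases "n < r")
      (auto simp: p_def inner_diff_left sum_scaleR_inner_orthonormal[OF eigen_systemD(1)[OF es]])
  ultimately have "B (w - p) = 0" using eigen_systemD(8)[OF es] W w by (blast intro: subspace_diff)
  then have "L (w - p) = 0" by (rule ker)
  then have "L w = L p" using L by (simp add: linear_diff)
  then show ?thesis unfolding p_def using L by (simp add: linear_sum linear_scale)
qed

text \<open>A family that maximises the sum of the squared norms spans an invariant subspace of
  \<open>B = T* T\<close>: otherwise rotating one vector towards the complement
  would increase the sum. Diagonalising \<open>B\<close> on that subspace and on its complement separately
  gives a singular value decomposition whose first \<open>r\<close> terms are as required.\<close>

theorem optimal_family_truncated_svd:
  fixes T :: "'b::{real_inner, banach} \<Rightarrow> 'c::real_inner"
  assumes B: "positive_selfadjoint B" "compact_map B" and BT: "\<And>h k. B h \<bullet> k = T h \<bullet> T k"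
    and T: "bounded_linear T" and a: "orthonormal_or_zero a"
    and opt: "\<forall>c. orthonormal_or_zero c \<longrightarrow> (\<Sum>k<r. (norm (T (c k)))\<^sup>2) \<le> (\<Sum>k<r. (norm (T (a k)))\<^sup>2)"
  shows "is_truncated_svd r T (finite_rank_op r (\<lambda>j. T (a j)) a)"
proof -
  interpret T: bounded_linear T by fact
  have blB: "bounded_linear B" using B by (simp add: positive_selfadjoint_def)
  interpret B: bounded_linear B by fact
  have sym: "B u \<bullet> v = u \<bullet> B v" for u v using B by (simp add: positive_selfadjoint_def)
  have kerB: "T u = 0" if "B u = 0" for u using BT[of u u] that by simp
  have Bq: "B u \<bullet> u = (norm (T u))\<^sup>2" for u by (simp add: BT power2_norm_eq_inner)
  let ?P = "finite_rank_op r a a"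
  have P_bl: "bounded_linear ?P" by (rule bounded_linear_finite_rank_op)
  interpret P: bounded_linear ?P by fact
  have P_inner: "?P h \<bullet> a j = h \<bullet> a j" if "j < r" for h j
    unfolding finite_rank_op_def using that by (simp add: sum_scaleR_inner_orthonormal[OF a])
  have P_sym: "?P h \<bullet> k = h \<bullet> ?P k" for h k
    by (simp add: finite_rank_op_def inner_sum_left inner_sum_right inner_commute mult_ac)
  \<comment> \<open>The span of the first \<open>r\<close> vectors \<open>a j\<close>, written as
    the fixed points of the projection so that closedness is a matter of continuity.\<close>
  define W where "W = {w. w = ?P w}"
  have Wsub: "subspace W"
    unfolding subspace_def W_def by (auto simp: P.add P.scaleR P.zero)
  have Wcl: "closed W"
    unfolding W_def by (intro closed_Collect_eq continuous_intros linear_continuous_on P_bl)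
  have PW: "?P h \<in> W" for h
  proof -
    have "(\<Sum>j<r. (?P h \<bullet> a j) *\<^sub>R a j) = (\<Sum>j<r. (h \<bullet> a j) *\<^sub>R a j)" by (simp add: P_inner)
    then show ?thesis by (simp add: W_def finite_rank_op_def)
  qed
  have aW: "a j \<in> W" if "j < r" for j
  proof -
    have "?P (a j) = (\<Sum>k<r. if k = j then a j else 0)"
      unfolding finite_rank_op_def by (rule sum.cong) (auto simp: orthonormal_or_zeroD[OF a])
    then show ?thesis using that by (simp add: W_def)
  qed
  note replace = optimal_family_replace[OF T a opt]
  \<comment> \<open>The rotated vector \<open>a j - t *\<^sub>R v\<close> is an admissible
    replacement for every \<open>t\<close>; at \<open>t = 0\<close> the inequality is an equality,
    so its linear coefficient vanishes.\<close>
  have Ba_orth: "B (a j) \<bullet> v = 0" if j: "j < r" and v: "\<And>k. k < r \<Longrightarrow> v \<bullet> a k = 0" for j v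
  proof (cases "a j = 0")
    case False
    then have n1: "(norm (a j))\<^sup>2 = 1"
      using orthonormal_or_zeroD[OF a, of j j] by (simp add: power2_norm_eq_inner)
    show ?thesis
    proof (rule quadratic_nonneg_imp_linear_zero)
      show "0 \<le> (norm (T (a j)))\<^sup>2 * (norm v)\<^sup>2 - (norm (T v))\<^sup>2"
        using replace[OF j, of v] v by simp
      fix t
      have "(norm (T (a j - t *\<^sub>R v)))\<^sup>2 \<le> (norm (T (a j)))\<^sup>2 * (norm (a j - t *\<^sub>R v))\<^sup>2"
        using v by (intro replace[OF j]) (simp add: inner_diff_left orthonormal_or_zeroD[OF a])
      moreover have "(norm (a j - t *\<^sub>R v))\<^sup>2 = 1 + t\<^sup>2 * (norm v)\<^sup>2"
        using n1 v[OF j] unfolding power2_norm_eq_inner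
        by (simp add: inner_diff_left inner_diff_right inner_commute power2_eq_square)
      moreover have "(norm (T (a j - t *\<^sub>R v)))\<^sup>2
          = (norm (T (a j)))\<^sup>2 - 2 * t * (B (a j) \<bullet> v) + t\<^sup>2 * (norm (T v))\<^sup>2"
        unfolding power2_norm_eq_inner BT
        by (simp add: T.diff T.scaleR inner_diff_left inner_diff_right inner_commute power2_eq_square)
      ultimately show "0 \<le> 2 * t * (B (a j) \<bullet> v) + t\<^sup>2 * ((norm (T (a j)))\<^sup>2 * (norm v)\<^sup>2 - (norm (T v))\<^sup>2)"
        by (simp add: algebra_simps)
    qed
  qed (simp add: B.zero)
  have Ba: "B (a j) \<in> W" if j: "j < r" for j
  proof -
    \<comment> \<open>The component of \<open>B (a j)\<close> orthogonal to \<open>W\<close>; by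
      \<open>Ba_orth\<close> it is orthogonal to \<open>B (a j)\<close> too, hence to
      itself.\<close>
    define v where "v = B (a j) - ?P (B (a j))"
    have v: "v \<bullet> a k = 0" if "k < r" for k using that by (simp add: v_def inner_diff_left P_inner)
    have "?P (B (a j)) \<bullet> v = 0"
      unfolding finite_rank_op_def inner_sum_left using v by (simp add: inner_commute)
    then have "v \<bullet> v = 0" using Ba_orth[OF j, of v] v by (simp add: v_def inner_diff_left)
    then have "B (a j) = ?P (B (a j))" by (simp add: v_def)
    then show ?thesis by (simp add: W_def)
  qed
  have BW: "B ` W \<subseteq> W"
  proof clarify
    fix w assume "w \<in> W"
    then have "B w = B (?P w)" by (simp add: W_def)
    also have "\<dots> = (\<Sum>j<r. (w \<bullet> a j) *\<^sub>R B (a j))" by (simp add: finite_rank_op_def B.sum B.scaleR)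
    also have "\<dots> \<in> W" using Wsub Ba by (intro subspace_sum subspace_scale) auto
    finally show "B w \<in> W" .
  qed
  obtain e1 l1 where es1: "eigen_system W B e1 l1"
    using eigen_system_exists[OF B Wsub Wcl BW] by blast
  note e1 = eigen_systemD(1)[OF es1]
  \<comment> \<open>A dimension count: by monotonicity a nonzero entry at some
    \<open>n \<ge> r\<close> gives \<open>r + 1\<close> unit vectors in \<open>W\<close>. Their
    squared coefficients along \<open>a\<close> add up to \<open>r + 1\<close>, but Bessel's
    inequality leaves at most \<open>r\<close>.\<close>
  have fin: "e1 n = 0" if "r \<le> n" for n
  proof (rule ccontr)
    assume "e1 n \<noteq> 0"
    have ne: "(norm (e1 i))\<^sup>2 = 1" if "i < Suc r" for i
    proof -
      have "l1 n \<le> l1 i" using decseqD[OF eigen_systemD(3)[OF es1], of i n] that \<open>r \<le> n\<close> by simp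
      moreover have "l1 n > 0"
        using \<open>e1 n \<noteq> 0\<close> eigen_systemD(4,6)[OF es1, of n] by simp
      ultimately have "e1 i \<noteq> 0" using eigen_systemD(6)[OF es1, of i] by auto
      then show ?thesis using orthonormal_or_zeroD[OF e1, of i i] by (simp add: power2_norm_eq_inner)
    qed
    have "(norm w)\<^sup>2 = (\<Sum>j<r. (a j \<bullet> w)\<^sup>2)" if "w \<in> W" for w
    proof -
      have "w \<bullet> w = ?P w \<bullet> w" using that by (simp add: W_def)
      then show ?thesis
        unfolding power2_norm_eq_inner finite_rank_op_def inner_sum_left
        by (simp add: power2_eq_square inner_commute)
    qed
    then have "real (Suc r) = (\<Sum>i<Suc r. \<Sum>j<r. (a j \<bullet> e1 i)\<^sup>2)"
      using ne eigen_systemD(2)[OF es1] by (simp del: sum.lessThan_Suc)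
    also have "\<dots> = (\<Sum>j<r. \<Sum>i<Suc r. (a j \<bullet> e1 i)\<^sup>2)" by (rule sum.swap)
    also have "\<dots> \<le> (\<Sum>j<r. (norm (a j))\<^sup>2)" by (intro sum_mono bessel_finite e1) simp
    also have "\<dots> \<le> real r" by (rule sum_norm_sq_orthonormal_le[OF a])
    finally show False by simp
  qed
  have Te1: "(norm (T (e1 n)))\<^sup>2 = l1 n" for n
    using orthonormal_or_zeroD[OF e1, of n n] eigen_systemD(6)[OF es1, of n]
    by (auto simp: Bq[symmetric] eigen_systemD(7)[OF es1])
  \<comment> \<open>The vectors \<open>a j\<close> need not be eigenvectors. The eigenvectors in the
    same span are shown to be optimal as well, so that the exchange lemma applies to them.\<close>
  have opt1: "\<forall>c. orthonormal_or_zero c \<longrightarrow>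
      (\<Sum>k<r. (norm (T (c k)))\<^sup>2) \<le> (\<Sum>k<r. (norm (T (e1 k)))\<^sup>2)"
  proof (intro allI impI)
    fix c :: "nat \<Rightarrow> 'b" assume c: "orthonormal_or_zero c"
    have "(norm (T (a j)))\<^sup>2 = (\<Sum>n<r. l1 n * (a j \<bullet> e1 n)\<^sup>2)" if "j < r" for j
    proof -
      have "B (a j) = (\<Sum>n<r. (a j \<bullet> e1 n) *\<^sub>R B (e1 n))"
        using aW[OF that] by (intro eigen_system_finite_expansion[OF es1 Wsub fin] B.linear) auto
      then have "B (a j) \<bullet> a j = (\<Sum>n<r. l1 n * (a j \<bullet> e1 n)\<^sup>2)"
        unfolding eigen_systemD(7)[OF es1]
        by (simp add: inner_sum_left power2_eq_square inner_commute[of "a j"] mult_ac)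
      then show ?thesis by (simp add: Bq)
    qed
    then have "(\<Sum>k<r. (norm (T (a k)))\<^sup>2) = (\<Sum>k<r. \<Sum>n<r. l1 n * (a k \<bullet> e1 n)\<^sup>2)" by simp
    also have "\<dots> = (\<Sum>n<r. l1 n * (\<Sum>k<r. (e1 n \<bullet> a k)\<^sup>2))"
      unfolding sum_distrib_left by (subst sum.swap) (simp add: inner_commute)
    also have "\<dots> \<le> (\<Sum>n<r. l1 n * 1)"
    proof (intro sum_mono mult_left_mono eigen_systemD(4)[OF es1])
      fix n
      have "(\<Sum>k<r. (e1 n \<bullet> a k)\<^sup>2) \<le> (norm (e1 n))\<^sup>2" by (intro bessel_finite a) simp
      also have "\<dots> \<le> 1" using orthonormal_or_zero_norm_le[OF e1] by (simp add: power_le_one)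
      finally show "(\<Sum>k<r. (e1 n \<bullet> a k)\<^sup>2) \<le> 1" .
    qed
    also have "\<dots> = (\<Sum>k<r. (norm (T (e1 k)))\<^sup>2)" by (simp add: Te1)
    finally show "(\<Sum>k<r. (norm (T (c k)))\<^sup>2) \<le> (\<Sum>k<r. (norm (T (e1 k)))\<^sup>2)"
      using opt c by (blast intro: order_trans)
  qed
  define V where "V = {v. \<forall>n. v \<bullet> e1 n = 0}"
  have Vsub: "subspace V" by (auto simp: V_def subspace_def inner_add_left)
  have Vcl: "closed V"
    unfolding V_def by (intro closed_Collect_all closed_Collect_eq continuous_intros)
  have BV: "B ` V \<subseteq> V" by (auto simp: V_def sym eigen_systemD(7)[OF es1])
  obtain e2 l2 where es2: "eigen_system V B e2 l2"
    using eigen_system_exists[OF B Vsub Vcl BV] by blast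
  \<comment> \<open>Exchanging \<open>e1 n\<close> for \<open>e2 m\<close> shows that the glued
    eigenvalues decrease across the junction. This includes \<open>e1 n = 0\<close>: an empty slot
    among the first \<open>r\<close> leaves nothing for the complement.\<close>
  have l2_le: "l2 m \<le> l1 n" if "n < r" for m n
  proof (cases "e2 m = 0")
    case True
    then show ?thesis using eigen_systemD(6)[OF es2, of m] eigen_systemD(4)[OF es1, of n] by simp
  next
    case False
    then have n1: "e2 m \<bullet> e2 m = 1"
      using orthonormal_or_zeroD[OF eigen_systemD(1)[OF es2], of m m] by simp
    have "(norm (T (e2 m)))\<^sup>2 \<le> (norm (T (e1 n)))\<^sup>2 * (norm (e2 m))\<^sup>2"
      using eigen_systemD(2)[OF es2, of m]
      by (intro optimal_family_replace[OF T e1 opt1 that]) (auto simp: V_def)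
    moreover have "(norm (T (e2 m)))\<^sup>2 = l2 m" using Bq[of "e2 m"] n1 by (simp add: eigen_systemD(7)[OF es2])
    ultimately show ?thesis using n1 by (simp add: Te1 power2_norm_eq_inner[of "e2 m"])
  qed
  define e l where "e n = (if n < r then e1 n else e2 (n - r))"
    and "l n = (if n < r then l1 n else l2 (n - r))" for n
  have cross: "e2 m \<bullet> e1 n = 0" "e1 n \<bullet> e2 m = 0" for m n
    using eigen_systemD(2)[OF es2, of m] by (auto simp: V_def inner_commute)
  have es: "eigen_system UNIV B e l"
    unfolding eigen_system_def
  proof (intro conjI allI ballI impI)
    show "orthonormal_or_zero e"
      unfolding orthonormal_or_zero_def
      by (auto simp: e_def cross orthonormal_or_zeroD[OF e1]
          orthonormal_or_zeroD[OF eigen_systemD(1)[OF es2]])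
    show "decseq l"
    proof (rule decseq_SucI)
      fix n
      show "l (Suc n) \<le> l n"
        using decseqD[OF eigen_systemD(3)[OF es1], of n "Suc n"]
          decseqD[OF eigen_systemD(3)[OF es2], of "n - r" "Suc n - r"] l2_le[of n]
        by (auto simp: l_def)
    qed
    have "(\<lambda>n. l (n + r)) \<longlonglongrightarrow> 0" using eigen_systemD(5)[OF es2] by (simp add: l_def)
    then show "l \<longlonglongrightarrow> 0" by (rule LIMSEQ_offset)
    fix u assume u: "\<forall>n. u \<bullet> e n = 0"
    have "u \<bullet> e1 n = 0" for n using u[rule_format, of n] fin[of n] by (cases "n < r") (auto simp: e_def)
    then have "u \<in> V" by (simp add: V_def)
    moreover have "u \<bullet> e2 n = 0" for n using u[rule_format, of "n + r"] by (simp add: e_def)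
    ultimately show "B u = 0" using eigen_systemD(8)[OF es2] by blast
  qed (use eigen_systemD(4,6,7)[OF es1] eigen_systemD(4,6,7)[OF es2] in \<open>auto simp: e_def l_def\<close>)
  have "finite_rank_op r (\<lambda>j. T (a j)) a h
      = finite_rank_op r (\<lambda>i. sqrt (l i) *\<^sub>R (1 / sqrt (l i)) *\<^sub>R T (e i)) e h" for h
  proof -
    have "finite_rank_op r (\<lambda>j. T (a j)) a h = T (?P h)"
      by (simp add: finite_rank_op_def T.sum T.scaleR)
    also have "\<dots> = (\<Sum>n<r. (?P h \<bullet> e1 n) *\<^sub>R T (e1 n))"
      by (intro eigen_system_finite_expansion[OF es1 Wsub fin] T.linear kerB PW)
    also have "\<dots> = (\<Sum>n<r. (h \<bullet> e1 n) *\<^sub>R T (e1 n))"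
    proof -
      have "e1 n = ?P (e1 n)" for n using eigen_systemD(2)[OF es1, of n] by (simp add: W_def)
      then show ?thesis by (simp add: P_sym)
    qed
    also have "\<dots> = finite_rank_op r (\<lambda>i. sqrt (l i) *\<^sub>R (1 / sqrt (l i)) *\<^sub>R T (e i)) e h"
      unfolding finite_rank_op_def
    proof (rule sum.cong)
      fix i assume "i \<in> {..<r}"
      then have *: "e i = e1 i" "l i = l1 i" by (auto simp: e_def l_def)
      show "(h \<bullet> e1 i) *\<^sub>R T (e1 i) = (h \<bullet> e i) *\<^sub>R sqrt (l i) *\<^sub>R (1 / sqrt (l i)) *\<^sub>R T (e i)"
        using eigen_systemD(6)[OF es1, of i] unfolding * by auto
    qed simp
    finally show ?thesis .
  qed
  then show ?thesis
    unfolding is_truncated_svd_iff using svd_system_of_eigen_system[OF T BT es] by blast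
qed

subsection \<open>Rank-constrained regression\<close>

lemma subspace_closure:
  fixes V :: "'b::real_normed_vector set"
  assumes "subspace V"
  shows "subspace (closure V)"
  unfolding subspace_def
proof (intro conjI ballI allI)
  show "0 \<in> closure V" using subspace_0[OF assms] closure_subset by blast
next
  fix u v assume "u \<in> closure V" "v \<in> closure V"
  then obtain f g where "\<And>n. f n \<in> V" "f \<longlonglongrightarrow> u" "\<And>n. g n \<in> V" "g \<longlonglongrightarrow> v"
    unfolding closure_sequential by blast
  then show "u + v \<in> closure V"
    unfolding closure_sequential using subspace_add[OF assms]
    by (intro exI[of _ "\<lambda>n. f n + g n"]) (auto intro: tendsto_add)
next
  fix c u assume "u \<in> closure V"
  then obtain f where "\<And>n. f n \<in> V" "f \<longlonglongrightarrow> u"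
    unfolding closure_sequential by blast
  then show "c *\<^sub>R u \<in> closure V"
    unfolding closure_sequential using subspace_scale[OF assms]
    by (intro exI[of _ "\<lambda>n. c *\<^sub>R f n"]) (auto intro: tendsto_scaleR)
qed

locale covariance_pair =
  fixes M :: "'a measure"
    and x :: "'a \<Rightarrow> 'f::{real_inner, banach, second_countable_topology}"
    and y :: "'a \<Rightarrow> 'g::{real_inner, banach, second_countable_topology}"
  assumes x: "x \<in> L2 M" and y: "y \<in> L2 M"
begin

definition "Cy = cov M y y"
definition "Cyx = cov M y x"
definition "S = op_sqrt Cy"
definition "T = mp_inv S \<circ> Cyx"
definition "risk A = (\<integral>\<omega>. (norm (x \<omega> - A (y \<omega>)))\<^sup>2 \<partial>M)"
definition "energy = (\<integral>\<omega>. (norm (x \<omega>))\<^sup>2 \<partial>M)"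

section \<open>The square root of the covariance and its kernel\<close>

lemma Cy_inner: "Cy e \<bullet> f = (\<integral>\<omega>. (y \<omega> \<bullet> f) * (e \<bullet> y \<omega>) \<partial>M)"
  unfolding Cy_def using cov_eq_integral(3)[OF y y] .

lemma Cyx_inner: "Cyx e \<bullet> f = (\<integral>\<omega>. (y \<omega> \<bullet> f) * (e \<bullet> x \<omega>) \<partial>M)"
  unfolding Cyx_def using cov_eq_integral(3)[OF y x] .

lemma Cy_positive_selfadjoint: "positive_selfadjoint Cy"
  unfolding Cy_def using y by (rule positive_selfadjoint_cov)

lemma Cy_eigen_system: "\<exists>g l. eigen_system UNIV Cy g l"
  using Cy_positive_selfadjoint compact_map_cov[OF y] unfolding Cy_def
  by (intro eigen_system_exists) auto

lemma S_positive_selfadjoint: "positive_selfadjoint S" and S_S: "S \<circ> S = Cy"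
  using Cy_eigen_system op_sqrt_eigen_system[OF Cy_positive_selfadjoint] unfolding S_def by blast+

lemma bounded_linear_S: "bounded_linear S"
  using S_positive_selfadjoint by (simp add: positive_selfadjoint_def)

lemma linear_S: "linear S"
  using bounded_linear_S by (rule bounded_linear.linear)

lemma S_sym: "S u \<bullet> v = u \<bullet> S v"
  using S_positive_selfadjoint by (simp add: positive_selfadjoint_def)

lemma S_inner_S: "S u \<bullet> S v = Cy u \<bullet> v"
  using S_S by (metis S_sym comp_apply inner_commute)

lemma ker_S: "ker S = ker Cy"
proof -
  have "S u = 0 \<longleftrightarrow> Cy u = 0" for u
    using S_inner_S[of u u] S_S linear_0[OF linear_S] by (metis comp_apply inner_eq_zero_iff inner_zero_left)
  then show ?thesis by (simp add: ker_def)
qed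

text \<open>Symmetry of \<open>S\<close> makes the eigenvectors of \<open>Cy\<close> orthogonal to
  \<open>ker S\<close>, and \<open>S\<close> kills what is orthogonal to all of them; the Fourier
  projection separates the two parts.\<close>

lemma S_decomposition: "\<exists>p. p \<in> orthogonal_comp (ker S) \<and> u - p \<in> ker S"
proof -
  obtain g l where es: "eigen_system UNIV Cy g l" using Cy_eigen_system by blast
  note S_g = sqrt_on_eigen_system[OF es S_positive_selfadjoint S_S]
  have "g n \<in> orthogonal_comp (ker S)" for n
    unfolding orthogonal_comp_def orthogonal_def ker_def
  proof clarify
    fix k assume k: "S k = 0"
    have "sqrt (l n) * (k \<bullet> g n) = k \<bullet> S (g n)" by (simp add: S_g)
    also have "\<dots> = 0" by (simp add: S_sym[symmetric] k)
    finally show "k \<bullet> g n = 0" using eigen_systemD(6)[OF es, of n] by auto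
  qed
  moreover have "closed (orthogonal_comp (ker S))"
    unfolding orthogonal_comp_def orthogonal_def Ball_def
    by (intro closed_Collect_all closed_Collect_imp open_Collect_const closed_Collect_eq continuous_intros)
  ultimately have "fourier_proj g u \<in> orthogonal_comp (ker S)"
    using eigen_systemD(1)[OF es] subspace_orthogonal_comp by (intro fourier_proj_mem)
  moreover have "S (u - fourier_proj g u) = 0"
    by (intro S_g(2) fourier_proj_orthogonal eigen_systemD(1)[OF es])
  ultimately show ?thesis by (auto simp: ker_def)
qed

lemma mp_inv_S:
  assumes "v \<in> range S"
  shows "S (mp_inv S v) = v" "mp_inv S v \<in> orthogonal_comp (ker S)"
proof -
  obtain w where w: "v = S w" using assms by blast
  obtain p where p: "p \<in> orthogonal_comp (ker S)" "w - p \<in> ker S" using S_decomposition by blast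
  have "S p = v" using p(2) w linear_S by (simp add: ker_def linear_diff)
  then show "S (mp_inv S v) = v" "mp_inv S v \<in> orthogonal_comp (ker S)"
    using mp_inv_eqI[OF linear_S p(1)] p(1) by auto
qed

text \<open>Stated for arbitrary families: the Bessel bound in \<open>T_expansion\<close> applies it
  with vectors \<open>t n\<close> that are not orthonormal.\<close>

lemma integral_sq_diff_finite_rank_op:
  "(\<integral>\<omega>. (norm (x \<omega> - finite_rank_op r a b (y \<omega>)))\<^sup>2 \<partial>M) =
     energy - 2 * (\<Sum>j<r. Cyx (a j) \<bullet> b j) + (\<Sum>j<r. \<Sum>k<r. (a j \<bullet> a k) * (Cy (b k) \<bullet> b j))"
proof -
  have "(norm (x \<omega> - finite_rank_op r a b (y \<omega>)))\<^sup>2 =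
      (norm (x \<omega>))\<^sup>2 - 2 * (\<Sum>j<r. (y \<omega> \<bullet> b j) * (a j \<bullet> x \<omega>)) +
      (\<Sum>j<r. \<Sum>k<r. (a j \<bullet> a k) * ((y \<omega> \<bullet> b j) * (b k \<bullet> y \<omega>)))" for \<omega>
  proof -
    have "x \<omega> \<bullet> finite_rank_op r a b (y \<omega>) = (\<Sum>j<r. (y \<omega> \<bullet> b j) * (a j \<bullet> x \<omega>))"
      by (simp add: finite_rank_op_def inner_sum_right inner_commute[of "x \<omega>"])
    moreover have "finite_rank_op r a b (y \<omega>) \<bullet> finite_rank_op r a b (y \<omega>)
        = (\<Sum>j<r. \<Sum>k<r. (a j \<bullet> a k) * ((y \<omega> \<bullet> b j) * (b k \<bullet> y \<omega>)))"
      unfolding finite_rank_op_def inner_sum_left unfolding inner_sum_right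
      by (simp add: inner_commute[of "y \<omega>"] mult_ac)
    ultimately show ?thesis
      unfolding power2_norm_eq_inner inner_diff_left inner_diff_right
        inner_commute[of "finite_rank_op r a b (y \<omega>)" "x \<omega>"] by simp
  qed
  moreover have "integrable M (\<lambda>\<omega>. (norm (x \<omega>))\<^sup>2)" using x by (simp add: L2_def)
  ultimately show ?thesis
    using L2_integrable_inner_mult[OF y x] L2_integrable_inner_mult[OF y y]
    by (simp add: energy_def Cyx_inner Cy_inner)
qed

text \<open>The vectors \<open>t n\<close> below are the coefficients of \<open>x\<close> with respect to the family
  \<open>(y \<bullet> g n) / sqrt (l n)\<close>, which is orthonormal in \<open>L\<^sup>2\<close>; Bessel's inequality bounds them.\<close>

lemma T_expansion:
  "\<exists>g t. orthonormal_or_zero g \<and> (\<forall>n. g n \<in> range S) \<and> (\<forall>n. g n = 0 \<longrightarrow> t n = 0) \<and>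
     summable (\<lambda>n. (norm (t n))\<^sup>2) \<and> (\<forall>e. (\<lambda>n. (e \<bullet> t n) *\<^sub>R g n) sums T e) \<and>
     (\<forall>e. S (T e) = Cyx e)"
proof -
  obtain g l where es: "eigen_system UNIV Cy g l" using Cy_eigen_system by blast
  note g = eigen_systemD(1)[OF es] and l0 = eigen_systemD(4)[OF es] and gl = eigen_systemD(6)[OF es]
  note S_g = sqrt_on_eigen_system[OF es S_positive_selfadjoint S_S]
  \<comment> \<open>The preimages of \<open>g n\<close> under \<open>S\<close>, equal to 0 where
    \<open>l n = 0\<close>.\<close>
  define b where "b n = (1 / sqrt (l n)) *\<^sub>R g n" for n
  define t where "t n = cov M x y (b n)" for n
  have t_inner: "e \<bullet> t n = Cyx e \<bullet> b n" for e n
    unfolding Cyx_inner inner_commute[of e] t_def cov_eq_integral(3)[OF x y]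
    by (simp add: inner_commute mult.commute)
  have t0: "t n = 0" if "g n = 0" for n using t_inner[of "t n" n] that by (simp add: b_def)
  have Cy_b: "Cy (b k) \<bullet> b j = (if j = k \<and> g j \<noteq> 0 then 1 else 0)" for j k
  proof -
    have "Cy (b k) \<bullet> b j = (l k / (sqrt (l k) * sqrt (l j))) * (g k \<bullet> g j)"
      using Cy_positive_selfadjoint bounded_linear.linear[of Cy]
      by (simp add: b_def linear_scale eigen_systemD(7)[OF es] positive_selfadjoint_def)
    then show ?thesis using gl[of j] l0[of j] by (auto simp: orthonormal_or_zeroD[OF g])
  qed
  \<comment> \<open>The mean squared error of \<open>finite_rank_op N t b\<close> is
    \<open>energy\<close> minus the sum on the left, and it is nonnegative.\<close>
  have bessel: "(\<Sum>n<N. (norm (t n))\<^sup>2) \<le> energy" for N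
  proof -
    have "(\<Sum>j<N. \<Sum>k<N. (t j \<bullet> t k) * (Cy (b k) \<bullet> b j)) = (\<Sum>j<N. (norm (t j))\<^sup>2)"
    proof (rule sum.cong)
      fix j assume "j \<in> {..<N}"
      have "(\<Sum>k<N. (t j \<bullet> t k) * (Cy (b k) \<bullet> b j)) = (\<Sum>k<N. if j = k then (norm (t j))\<^sup>2 else 0)"
        by (rule sum.cong) (auto simp: Cy_b t0 power2_norm_eq_inner)
      then show "(\<Sum>k<N. (t j \<bullet> t k) * (Cy (b k) \<bullet> b j)) = (norm (t j))\<^sup>2"
        using \<open>j \<in> {..<N}\<close> by simp
    qed simp
    moreover have "(\<Sum>j<N. Cyx (t j) \<bullet> b j) = (\<Sum>j<N. (norm (t j))\<^sup>2)"
      by (simp add: t_inner[symmetric] power2_norm_eq_inner)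
    moreover have "0 \<le> (\<integral>\<omega>. (norm (x \<omega> - finite_rank_op N t b (y \<omega>)))\<^sup>2 \<partial>M)" by simp
    ultimately show ?thesis unfolding integral_sq_diff_finite_rank_op by simp
  qed
  have t_sum: "summable (\<lambda>n. (norm (t n))\<^sup>2)"
    by (rule bounded_imp_summable[where B = energy])
      (use bessel[of "Suc _"] in \<open>auto simp: lessThan_Suc_atMost\<close>)
  have et_sum: "summable (\<lambda>n. (e \<bullet> t n)\<^sup>2)" for e
  proof (rule summable_comparison_test'[OF summable_mult[OF t_sum, of "(norm e)\<^sup>2"]])
    fix n
    have "\<bar>e \<bullet> t n\<bar>\<^sup>2 \<le> (norm e * norm (t n))\<^sup>2" by (intro power_mono Cauchy_Schwarz_ineq2) simp
    then show "norm ((e \<bullet> t n)\<^sup>2) \<le> (norm e)\<^sup>2 * (norm (t n))\<^sup>2" by (simp add: power_mult_distrib)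
  qed
  define R where "R e = (\<Sum>n. (e \<bullet> t n) *\<^sub>R g n)" for e
  have R_sums: "(\<lambda>n. (e \<bullet> t n) *\<^sub>R g n) sums R e" for e
    unfolding R_def by (intro summable_sums summable_orthonormal g et_sum)
  have R_g: "R e \<bullet> g n = e \<bullet> t n" for e n
    unfolding R_def by (intro suminf_orthonormal_inner g et_sum) (simp add: t0)
  have R_ker: "R e \<in> orthogonal_comp (ker S)" for e
    unfolding orthogonal_comp_def orthogonal_def ker_def
  proof clarify
    fix k assume k: "S k = 0"
    have "g n \<bullet> k = 0" for n
    proof -
      have "sqrt (l n) * (g n \<bullet> k) = S (g n) \<bullet> k" by (simp add: S_g)
      also have "\<dots> = 0" by (simp add: S_sym k)
      finally show ?thesis using gl[of n] by auto
    qed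
    then show "k \<bullet> R e = 0"
      using bounded_linear.sums[OF bounded_linear_inner_left[of k] R_sums[of e]] sums_unique2[OF sums_zero]
      by (simp add: inner_commute[of k])
  qed
  have S_R: "S (R e) = Cyx e" for e
  proof -
    \<comment> \<open>\<open>d\<close> is orthogonal to every \<open>g n\<close>, hence
      \<open>Cy d = 0\<close> and \<open>y \<omega> \<bullet> d\<close> vanishes almost everywhere.
      So \<open>d\<close> is orthogonal to \<open>Cyx e\<close>, and by symmetry of \<open>S\<close>
      also to \<open>S (R e)\<close>.\<close>
    define d where "d = S (R e) - Cyx e"
    have "S (R e) \<bullet> g n = Cyx e \<bullet> g n" for n
      using gl[of n] by (cases "l n = 0") (auto simp: S_sym S_g R_g t_inner b_def)
    then have "Cy d = 0" using eigen_systemD(8)[OF es] by (simp add: d_def inner_diff_left)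
    then have "S d = 0" using ker_S by (auto simp: ker_def)
    then have "S (R e) \<bullet> d = 0" by (simp add: S_sym)
    moreover have "Cyx e \<bullet> d = 0"
    proof -
      have "integrable M (\<lambda>\<omega>. (y \<omega> \<bullet> d)\<^sup>2)"
        using L2_integrable_inner_mult[OF y y, of d d] by (simp add: power2_eq_square inner_commute)
      moreover have "(\<integral>\<omega>. (y \<omega> \<bullet> d)\<^sup>2 \<partial>M) = 0"
        using Cy_inner[of d d] \<open>Cy d = 0\<close> by (simp add: power2_eq_square inner_commute)
      ultimately have "AE \<omega> in M. (y \<omega> \<bullet> d)\<^sup>2 = 0"
        by (subst (asm) integral_nonneg_eq_0_iff_AE) auto
      then have "AE \<omega> in M. (y \<omega> \<bullet> d) * (e \<bullet> x \<omega>) = 0" by auto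
      then show ?thesis unfolding Cyx_inner by (rule integral_eq_zero_AE)
    qed
    ultimately have "d \<bullet> d = 0" by (simp add: d_def inner_diff_left)
    then show ?thesis by (simp add: d_def)
  qed
  \<comment> \<open>Here the Moore--Penrose inverse is evaluated: \<open>S_R\<close> puts
    \<open>Cyx e\<close> into the range of \<open>S\<close>, and \<open>R_ker\<close> identifies the
    preimage.\<close>
  have T_R: "T e = R e" for e using mp_inv_eqI[OF linear_S R_ker] by (simp add: T_def S_R)
  have "g n \<in> range S" for n
  proof -
    have "g n = S (b n)" using gl[of n] l0[of n] linear_S by (auto simp: b_def linear_scale S_g linear_0)
    then show ?thesis by blast
  qed
  then show ?thesis using g t0 t_sum R_sums S_R unfolding T_R by blast
qed

lemma S_T: "S (T e) = Cyx e"
  using T_expansion by blast+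

lemma T_closure: "T e \<in> closure (range S)"
proof -
  obtain g t where g: "\<And>n. g n \<in> range S" and sums: "(\<lambda>n. (e \<bullet> t n) *\<^sub>R g n) sums T e"
    using T_expansion by blast
  have "subspace (range S)" using linear_S by (simp add: linear_subspace_image)
  then have "(\<Sum>n<N. (e \<bullet> t n) *\<^sub>R g n) \<in> range S" for N
    using g by (intro subspace_sum subspace_scale)
  then show ?thesis
    using sums unfolding closure_sequential sums_def
    by (intro exI[of _ "\<lambda>N. \<Sum>n<N. (e \<bullet> t n) *\<^sub>R g n"] conjI allI)
qed

lemma bounded_linear_T: "bounded_linear T"
  and T_gram: "\<exists>B. positive_selfadjoint B \<and> compact_map B \<and> (\<forall>h k. B h \<bullet> k = T h \<bullet> T k)"
proof -
  obtain g t where g: "orthonormal_or_zero g" and t0: "\<And>n. g n = 0 \<Longrightarrow> t n = 0"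
    and t_sum: "summable (\<lambda>n. (norm (t n))\<^sup>2)" and T_sums: "\<And>e. (\<lambda>n. (e \<bullet> t n) *\<^sub>R g n) sums T e"
    using T_expansion by blast
  \<comment> \<open>The squared Hilbert--Schmidt norm of \<open>T\<close>, used as a bound for the
    operator norm.\<close>
  define K where "K = (\<Sum>n. (norm (t n))\<^sup>2)"
  have K: "(\<Sum>n<N. (norm (t n))\<^sup>2) \<le> K" for N
    unfolding K_def by (rule sum_le_suminf[OF t_sum]) auto
  have "0 \<le> K" using K[of 0] by simp
  show "bounded_linear T"
  proof (rule bounded_linear_intro)
    show "T (a + b) = T a + T b" for a b
      using sums_unique2[OF T_sums[of "a + b"]] sums_add[OF T_sums[of a] T_sums[of b]]
      by (simp add: inner_add_left scaleR_left_distrib)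
    show "T (k *\<^sub>R a) = k *\<^sub>R T a" for k a
      using sums_unique2[OF T_sums[of "k *\<^sub>R a"]] bounded_linear.sums[OF bounded_linear_scaleR_right[of k] T_sums[of a]]
      by simp
    show "norm (T a) \<le> norm a * sqrt K" for a
    proof (rule LIMSEQ_le_const2)
      show "(\<lambda>N. norm (\<Sum>n<N. (a \<bullet> t n) *\<^sub>R g n)) \<longlonglongrightarrow> norm (T a)"
        using T_sums unfolding sums_def by (intro tendsto_norm)
      have "norm (\<Sum>n<N. (a \<bullet> t n) *\<^sub>R g n) \<le> norm a * sqrt K" for N
      proof (rule power2_le_imp_le)
        have "(norm (\<Sum>n<N. (a \<bullet> t n) *\<^sub>R g n))\<^sup>2 \<le> (\<Sum>n<N. \<bar>a \<bullet> t n\<bar>\<^sup>2)"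
          by (subst norm_sum_orthonormal[OF g]) (auto intro!: sum_mono)
        also have "\<dots> \<le> (\<Sum>n<N. (norm a * norm (t n))\<^sup>2)"
          by (intro sum_mono power_mono Cauchy_Schwarz_ineq2) simp
        also have "\<dots> = (norm a)\<^sup>2 * (\<Sum>n<N. (norm (t n))\<^sup>2)"
          by (simp add: power_mult_distrib sum_distrib_left)
        also have "\<dots> \<le> (norm a)\<^sup>2 * K" by (intro mult_left_mono K) simp
        finally show "(norm (\<Sum>n<N. (a \<bullet> t n) *\<^sub>R g n))\<^sup>2 \<le> (norm a * sqrt K)\<^sup>2"
          using \<open>0 \<le> K\<close> by (simp add: power_mult_distrib)
      qed (use \<open>0 \<le> K\<close> in simp)
      then show "\<exists>N. \<forall>n\<ge>N. norm (\<Sum>i<n. (a \<bullet> t i) *\<^sub>R g i) \<le> norm a * sqrt K" by blast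
    qed
  qed
  have t_L2: "t \<in> L2 (count_space UNIV)"
    using t_sum by (simp add: L2_def integrable_count_space_nat_iff)
  have g_T: "g n \<bullet> T k = k \<bullet> t n" for n k
  proof -
    have "(\<lambda>i. (k \<bullet> t i) * (g i \<bullet> g n)) sums (T k \<bullet> g n)"
      using bounded_linear.sums[OF bounded_linear_inner_left[of "g n"] T_sums[of k]] by simp
    moreover have "(\<lambda>i. (k \<bullet> t i) * (g i \<bullet> g n)) = (\<lambda>i. if i = n then k \<bullet> t n else 0)"
      using t0[of n] by (auto simp: orthonormal_or_zeroD[OF g])
    ultimately show ?thesis
      using sums_single[of n "\<lambda>_. k \<bullet> t n"] sums_unique2 by (metis inner_commute)
  qed
  let ?B = "cov (count_space UNIV) t t"
  have "?B h \<bullet> k = T h \<bullet> T k" for h k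
  proof -
    have "?B h \<bullet> k = (\<Sum>n. (t n \<bullet> k) * (h \<bullet> t n))"
      unfolding cov_eq_integral(3)[OF t_L2 t_L2]
      by (rule integral_count_space_nat[OF L2_integrable_inner_mult[OF t_L2 t_L2]])
    moreover have "(\<lambda>n. (t n \<bullet> k) * (h \<bullet> t n)) sums (T h \<bullet> T k)"
      using bounded_linear.sums[OF bounded_linear_inner_left[of "T k"] T_sums[of h]]
      by (simp add: g_T inner_commute mult.commute)
    ultimately show ?thesis by (metis sums_unique)
  qed
  then show "\<exists>B. positive_selfadjoint B \<and> compact_map B \<and> (\<forall>h k. B h \<bullet> k = T h \<bullet> T k)"
    using positive_selfadjoint_cov[OF t_L2] compact_map_cov[OF t_L2] by blast
qed

section \<open>The infimum of the risk\<close>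

lemma T_svd_system: "\<exists>s e f. svd_system T s e f"
proof -
  obtain B where B: "positive_selfadjoint B" "compact_map B" "\<And>h k. B h \<bullet> k = T h \<bullet> T k"
    using T_gram by blast
  then obtain e l where "eigen_system UNIV B e l" using eigen_system_exists[of B UNIV] by auto
  then show ?thesis using svd_system_of_eigen_system[OF bounded_linear_T B(3)] by blast
qed

text \<open>The identity \<open>S (T e) = Cyx e\<close> turns the cross term into
  \<open>T (a j) \<bullet> S (b j)\<close>, which completes the square. An empty slot
  \<open>a j = 0\<close> contributes nothing to the operator, so \<open>b j\<close> has to vanish
  there too.\<close>

lemma risk_finite_rank_op:
  assumes a: "orthonormal_or_zero a" and ab: "\<forall>j. a j = 0 \<longrightarrow> b j = 0"
  shows "risk (finite_rank_op r a b) =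
    energy - (\<Sum>j<r. (norm (T (a j)))\<^sup>2) + (\<Sum>j<r. (norm (T (a j) - S (b j)))\<^sup>2)"
proof -
  have "(\<Sum>j<r. \<Sum>k<r. (a j \<bullet> a k) * (Cy (b k) \<bullet> b j)) = (\<Sum>j<r. (norm (S (b j)))\<^sup>2)"
  proof (rule sum.cong)
    fix j assume "j \<in> {..<r}"
    have "(\<Sum>k<r. (a j \<bullet> a k) * (Cy (b k) \<bullet> b j)) = (\<Sum>k<r. if j = k then (norm (S (b j)))\<^sup>2 else 0)"
      using ab linear_0[OF linear_S]
      by (intro sum.cong) (auto simp: orthonormal_or_zeroD[OF a] power2_norm_eq_inner S_inner_S[symmetric])
    then show "(\<Sum>k<r. (a j \<bullet> a k) * (Cy (b k) \<bullet> b j)) = (norm (S (b j)))\<^sup>2"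
      using \<open>j \<in> {..<r}\<close> by simp
  qed simp
  moreover have "(norm (T (a j) - S (b j)))\<^sup>2
      = (norm (T (a j)))\<^sup>2 - 2 * (Cyx (a j) \<bullet> b j) + (norm (S (b j)))\<^sup>2" for j
  proof -
    have "Cyx (a j) \<bullet> b j = T (a j) \<bullet> S (b j)" by (simp add: S_T[symmetric] S_sym)
    then show ?thesis
      unfolding power2_norm_eq_inner by (simp add: inner_diff_left inner_diff_right inner_commute)
  qed
  ultimately show ?thesis
    unfolding risk_def integral_sq_diff_finite_rank_op
    by (simp add: sum.distrib sum_subtractf sum_distrib_left)
qed

lemma risk_lower_bound:
  assumes svd: "svd_system T s e f" and "A \<in> B00 r"
  shows "energy - (\<Sum>i<r. (s i)\<^sup>2) \<le> risk A"
proof -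
  obtain a b where a: "orthonormal_or_zero a" "\<forall>j. a j = 0 \<longrightarrow> b j = 0" "A = finite_rank_op r a b"
    using B00_eq_finite_rank_op[OF assms(2)] by blast
  have "risk A = energy - (\<Sum>j<r. (norm (T (a j)))\<^sup>2) + (\<Sum>j<r. (norm (T (a j) - S (b j)))\<^sup>2)"
    unfolding a(3) by (rule risk_finite_rank_op[OF a(1,2)])
  moreover have "0 \<le> (\<Sum>j<r. (norm (T (a j) - S (b j)))\<^sup>2)" by (intro sum_nonneg) simp
  ultimately show ?thesis using Ky_Fan_le[OF svd a(1), of r] by linarith
qed

lemma risk_near_optimal:
  assumes svd: "svd_system T s e f" and "0 < \<delta>"
  shows "\<exists>A\<in>B00 r. risk A \<le> energy - (\<Sum>i<r. (s i)\<^sup>2) + \<delta>"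
proof -
  \<comment> \<open>Chosen so that \<open>r\<close> squared errors sum to at most
    \<open>\<delta>\<close>; the \<open>+ 1\<close> covers \<open>r = 0\<close>.\<close>
  define \<epsilon> where "\<epsilon> = sqrt (\<delta> / (real r + 1))"
  have "0 < \<epsilon>" using assms(2) by (simp add: \<epsilon>_def)
  have "\<exists>b. (e j = 0 \<longrightarrow> b = 0) \<and> norm (T (e j) - S b) < \<epsilon>" for j
  proof (cases "e j = 0")
    case True
    then show ?thesis
      using \<open>0 < \<epsilon>\<close> linear_0[OF linear_S] linear_0[OF bounded_linear.linear[OF bounded_linear_T]] by simp
  next
    case False
    obtain v where "v \<in> range S" "dist v (T (e j)) < \<epsilon>"
      using T_closure[of "e j"] \<open>0 < \<epsilon>\<close> unfolding closure_approachable by blast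
    then show ?thesis using False by (auto simp: dist_norm norm_minus_commute)
  qed
  then obtain b where b: "\<forall>j. e j = 0 \<longrightarrow> b j = 0" "\<And>j. norm (T (e j) - S (b j)) < \<epsilon>" by metis
  have "(\<Sum>j<r. (norm (T (e j) - S (b j)))\<^sup>2) \<le> (\<Sum>j<r. \<epsilon>\<^sup>2)"
    by (intro sum_mono power_mono less_imp_le[OF b(2)] norm_ge_zero)
  also have "\<dots> = real r * (\<delta> / (real r + 1))" using assms(2) by (simp add: \<epsilon>_def)
  also have "\<dots> \<le> \<delta>" using assms(2) by (simp add: field_simps)
  finally have "risk (finite_rank_op r e b) \<le> energy - (\<Sum>i<r. (s i)\<^sup>2) + \<delta>"
    unfolding risk_finite_rank_op[OF svd_systemD(4)[OF svd] b(1)] Ky_Fan_attained[OF svd] by simp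
  then show ?thesis using finite_rank_op_B00 by blast
qed

text \<open>The lower bound and the nearly optimal operators identify the infimum whether or not it
  is attained, so being a solution becomes a single inequality.\<close>

lemma is_solution_iff:
  assumes svd: "svd_system T s e f"
  shows "is_solution M r x y A \<longleftrightarrow> A \<in> B00 r \<and> risk A \<le> energy - (\<Sum>i<r. (s i)\<^sup>2)"
proof -
  have "is_solution M r x y A \<longleftrightarrow> A \<in> B00 r \<and> (\<forall>A'\<in>B00 r. risk A \<le> risk A')"
    unfolding is_solution_def is_arg_min_def risk_def by (auto simp: not_less)
  moreover have "risk A \<le> energy - (\<Sum>i<r. (s i)\<^sup>2)" if "\<forall>A'\<in>B00 r. risk A \<le> risk A'"
  proof (rule field_le_epsilon)
    fix \<delta> :: real assume "0 < \<delta>"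
    then show "risk A \<le> energy - (\<Sum>i<r. (s i)\<^sup>2) + \<delta>"
      using risk_near_optimal[OF svd] that by (meson order_trans)
  qed
  ultimately show ?thesis using risk_lower_bound[OF svd] by (meson order_trans)
qed

section \<open>Correspondence between minimal solutions and truncated decompositions\<close>

lemma orth_proj_ker_Cy:
  "orth_proj (orthogonal_comp (ker Cy)) u \<in> orthogonal_comp (ker Cy)"
  "u - orth_proj (orthogonal_comp (ker Cy)) u \<in> ker Cy"
proof -
  obtain p where p: "p \<in> orthogonal_comp (ker Cy)" "u - p \<in> ker Cy"
    using S_decomposition[of u] ker_S by auto
  moreover have "orth_proj (orthogonal_comp (ker Cy)) u = p"
    using p orthogonal_comp_subset by (intro orth_proj_eqI subspace_orthogonal_comp) auto
  ultimately show "orth_proj (orthogonal_comp (ker Cy)) u \<in> orthogonal_comp (ker Cy)"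
    "u - orth_proj (orthogonal_comp (ker Cy)) u \<in> ker Cy" by auto
qed

text \<open>For \<open>i < r\<close> the vector \<open>s i *\<^sub>R f i\<close> is
  \<open>U (e i)\<close>, so the range inclusion provides preimages \<open>b i\<close> under
  \<open>S\<close> orthogonal to the kernel. They cancel the last sum in the risk formula and give
  minimality at once. The third claim confirms that \<open>adjoint\<close> yields a genuine adjoint
  here.\<close>

lemma truncated_svd_solution:
  assumes U: "is_truncated_svd r T U" and range: "range U \<subseteq> range S"
  shows "is_solution M r x y (adjoint (mp_inv S \<circ> U))" (is ?sol)
    and "minimality Cy (adjoint (mp_inv S \<circ> U))" (is ?min)
    and "mp_inv S (U h) \<bullet> u = h \<bullet> adjoint (mp_inv S \<circ> U) u"
proof -
  obtain s e f where svd: "svd_system T s e f" and U_eq: "U = finite_rank_op r (\<lambda>i. s i *\<^sub>R f i) e"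
    using U unfolding is_truncated_svd_iff by blast
  note e = svd_systemD(4)[OF svd]
  define b where "b i = mp_inv S (s i *\<^sub>R f i)" for i
  have "s i *\<^sub>R f i \<in> range S" if "i < r" for i
  proof -
    have "U (e i) = (\<Sum>k<r. if k = i then s i *\<^sub>R f i else 0)"
      unfolding U_eq finite_rank_op_def
      by (rule sum.cong) (auto simp: orthonormal_or_zeroD[OF e] svd_systemD(6)[OF svd])
    then have "s i *\<^sub>R f i = U (e i)" using that by simp
    then show ?thesis using range by (metis range_subsetD)
  qed
  then have S_b: "S (b i) = s i *\<^sub>R f i" and b_ker: "b i \<in> orthogonal_comp (ker S)" if "i < r" for i
    using mp_inv_S that unfolding b_def by blast+
  have b0: "\<forall>i. e i = 0 \<longrightarrow> b i = 0"
    using mp_inv_eqI[OF linear_S subspace_0[OF subspace_orthogonal_comp]] svd_systemD(6)[OF svd]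
    by (simp add: b_def linear_0[OF linear_S])
  have inv_U: "mp_inv S \<circ> U = finite_rank_op r b e"
  proof
    fix h
    have "finite_rank_op r b e h \<in> orthogonal_comp (ker S)"
      unfolding finite_rank_op_def using b_ker
      by (intro subspace_sum subspace_scale subspace_orthogonal_comp) auto
    moreover have "S (finite_rank_op r b e h) = U h"
      using linear_S by (simp add: U_eq finite_rank_op_def linear_sum linear_scale S_b)
    ultimately show "(mp_inv S \<circ> U) h = finite_rank_op r b e h"
      using mp_inv_eqI[OF linear_S] by (metis comp_apply)
  qed
  have adj: "adjoint (mp_inv S \<circ> U) = finite_rank_op r e b"
    unfolding inv_U by (rule adjoint_finite_rank_op)
  have "risk (finite_rank_op r e b) = energy - (\<Sum>i<r. (s i)\<^sup>2)"
    unfolding risk_finite_rank_op[OF e b0] Ky_Fan_attained[OF svd]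
    by (simp add: svd_system_apply[OF svd] S_b)
  then show ?sol unfolding is_solution_iff[OF svd] adj using finite_rank_op_B00 by simp
  have "orth_proj (orthogonal_comp (ker Cy)) u \<bullet> b i = u \<bullet> b i" if "i < r" for i u
    using b_ker[OF that] orth_proj_ker_Cy(2)[of u] unfolding ker_S orthogonal_comp_def orthogonal_def
    by (auto simp: inner_diff_left)
  then show ?min
    unfolding minimality_def adj by (simp add: fun_eq_iff finite_rank_op_def)
  show "mp_inv S (U h) \<bullet> u = h \<bullet> adjoint (mp_inv S \<circ> U) u"
    unfolding adj fun_cong[OF inv_U, of h, unfolded comp_apply]
    by (simp add: finite_rank_op_def inner_sum_left inner_sum_right inner_commute mult_ac)
qed

lemma solution_truncated_svd:
  assumes sol: "is_solution M r x y A"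
  shows "\<exists>V. is_truncated_svd r T V \<and> range V \<subseteq> range S \<and>
    (minimality Cy A \<longrightarrow> A = adjoint (mp_inv S \<circ> V))"
proof -
  obtain s e f where svd: "svd_system T s e f" using T_svd_system by blast
  have A: "A \<in> B00 r" and risk_le: "risk A \<le> energy - (\<Sum>i<r. (s i)\<^sup>2)"
    using sol unfolding is_solution_iff[OF svd] by auto
  obtain a b where a: "orthonormal_or_zero a" and ab: "\<forall>j. a j = 0 \<longrightarrow> b j = 0"
    and A_eq: "A = finite_rank_op r a b"
    using B00_eq_finite_rank_op[OF A] by blast
  have risk: "risk A = energy - (\<Sum>j<r. (norm (T (a j)))\<^sup>2) + (\<Sum>j<r. (norm (T (a j) - S (b j)))\<^sup>2)"
    unfolding A_eq by (rule risk_finite_rank_op[OF a ab])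
  have nonneg: "0 \<le> (\<Sum>j<r. (norm (T (a j) - S (b j)))\<^sup>2)" by (intro sum_nonneg) simp
  have le: "(\<Sum>j<r. (norm (T (a j)))\<^sup>2) \<le> (\<Sum>i<r. (s i)\<^sup>2)" by (rule Ky_Fan_le[OF svd a])
  have "(\<Sum>j<r. (norm (T (a j) - S (b j)))\<^sup>2) = 0"
    using risk risk_le nonneg le by linarith
  then have T_S: "T (a j) = S (b j)" if "j < r" for j
    using that by (simp add: sum_nonneg_eq_0_iff)
  have "(\<Sum>j<r. (norm (T (a j)))\<^sup>2) = (\<Sum>i<r. (s i)\<^sup>2)"
    using risk risk_le nonneg le by linarith
  then have opt: "\<forall>c. orthonormal_or_zero c \<longrightarrow>
      (\<Sum>k<r. (norm (T (c k)))\<^sup>2) \<le> (\<Sum>k<r. (norm (T (a k)))\<^sup>2)"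
    using Ky_Fan_le[OF svd] by simp
  define V where "V = finite_rank_op r (\<lambda>j. T (a j)) a"
  have V: "is_truncated_svd r T V"
    unfolding V_def using T_gram optimal_family_truncated_svd[OF _ _ _ bounded_linear_T a opt] by blast
  have S_ba: "S (finite_rank_op r b a h) = V h" for h
    using linear_S by (simp add: V_def finite_rank_op_def linear_sum linear_scale T_S)
  then have range: "range V \<subseteq> range S" by (metis image_subsetI rangeI)
  have "A = adjoint (mp_inv S \<circ> V)" if min: "minimality Cy A"
  proof -
    \<comment> \<open>Minimality makes \<open>A\<close> vanish on \<open>ker Cy\<close>; its
      coefficient along \<open>a j\<close> is then 0, which is the orthogonality of
      \<open>b j\<close>.\<close>
    have b_ker: "b j \<in> orthogonal_comp (ker S)" if "j < r" for j
      unfolding orthogonal_comp_def orthogonal_def ker_S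
    proof clarify
      fix k assume k: "k \<in> ker Cy"
      have "orth_proj (orthogonal_comp (ker Cy)) k = 0"
        using k orthogonal_comp_subset subspace_orthogonal_comp
        by (intro orth_proj_eqI) (auto simp: subspace_0)
      then have "A k = 0"
        using min A_eq bounded_linear_finite_rank_op[of r a b] unfolding minimality_def
        by (metis comp_apply bounded_linear.linear linear_0)
      then have "(\<Sum>i<r. (k \<bullet> b i) *\<^sub>R a i) \<bullet> a j = 0" by (simp add: A_eq finite_rank_op_def)
      then show "k \<bullet> b j = 0"
        using that ab by (auto simp: sum_scaleR_inner_orthonormal[OF a] split: if_splits)
    qed
    have "(mp_inv S \<circ> V) h = finite_rank_op r b a h" for h
    proof -
      have "finite_rank_op r b a h \<in> orthogonal_comp (ker S)"
        unfolding finite_rank_op_def using b_ker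
        by (intro subspace_sum subspace_scale subspace_orthogonal_comp) auto
      then show ?thesis using mp_inv_eqI[OF linear_S] S_ba by (metis comp_apply)
    qed
    then have "mp_inv S \<circ> V = finite_rank_op r b a" by blast
    then show ?thesis by (simp add: adjoint_finite_rank_op A_eq)
  qed
  then show ?thesis using V range by blast
qed

text \<open>The adjoint relation recovers \<open>mp_inv S (U h)\<close> from the solution, and
  applying \<open>S\<close> recovers \<open>U h\<close>. This injectivity carries uniqueness of the
  solution back to the decomposition.\<close>

lemma truncated_svd_eqI:
  assumes U: "is_truncated_svd r T U" "range U \<subseteq> range S"
    and V: "is_truncated_svd r T V" "range V \<subseteq> range S"
    and eq: "adjoint (mp_inv S \<circ> U) = adjoint (mp_inv S \<circ> V)"
  shows "U = V"
proof
  fix h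
  have "mp_inv S (U h) = mp_inv S (V h)"
    using truncated_svd_solution(3)[OF U] truncated_svd_solution(3)[OF V] eq
    by (metis vector_eq_rdot)
  then show "U h = V h" using mp_inv_S(1) U(2) V(2) by (metis range_subsetD)
qed

text \<open>Identifies the truncations in the formula for the solution with those in the existence
  criterion.\<close>

lemma orth_proj_closure_T: "orth_proj (closure (range S)) \<circ> T = T"
proof
  fix e
  have "subspace (closure (range S))"
    using linear_S by (intro subspace_closure) (simp add: linear_subspace_image)
  then have "orth_proj (closure (range S)) (T e) = T e"
    using T_closure by (rule orth_proj_eqI) (simp add: subspace_0 subspace_orthogonal_comp)
  then show "(orth_proj (closure (range S)) \<circ> T) e = T e" by simp
qed

end

theorem corollary6p4:
  fixes M :: "'a measure"
    and x :: "'a \<Rightarrow> 'f::{real_inner, banach, second_countable_topology}"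
    and y :: "'a \<Rightarrow> 'g::{real_inner, banach, second_countable_topology}"
    and r :: nat
  defines "Cy \<equiv> cov M y y"
    and "Cyx \<equiv> cov M y x"
  defines "S \<equiv> op_sqrt Cy"
  defines "T \<equiv> mp_inv S \<circ> Cyx"
  assumes "prob_space M" and "countably_generated M"
    and "x \<in> L2 M" and "y \<in> L2 M"
  shows "((\<exists>A. is_solution M r x y A) \<longleftrightarrow>
           (\<exists>U. is_truncated_svd r T U \<and> range U \<subseteq> range S)) \<and>
         (\<forall>U. is_truncated_svd r (orth_proj (closure (range S)) \<circ> T) U \<and> range U \<subseteq> range S \<longrightarrow>
           (let A_hat = adjoint (mp_inv S \<circ> U) in
             is_solution M r x y A_hat \<and> minimality Cy A_hat \<and>
             ((\<forall>A. is_solution M r x y A \<and> minimality Cy A \<longrightarrow> A = A_hat) \<longleftrightarrow>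
              (\<exists>!V. is_truncated_svd r T V \<and> range V \<subseteq> range S))))"
proof -
  interpret P: covariance_pair M x y using assms(7,8) by unfold_locales
  have Cy: "Cy = P.Cy" and Cyx: "Cyx = P.Cyx" by (simp_all add: Cy_def Cyx_def P.Cy_def P.Cyx_def)
  have S: "S = P.S" by (simp add: S_def Cy P.S_def)
  have T: "T = P.T" by (simp add: T_def S Cyx P.T_def)
  note sol = P.truncated_svd_solution(1,2) and svd = P.solution_truncated_svd
  \<comment> \<open>The map from \<open>V\<close> to \<open>adjoint (mp_inv P.S \<circ> V)\<close>
    is a bijection from admissible truncations onto minimal solutions: \<open>sol\<close> gives its
    values, \<open>svd\<close> surjectivity, \<open>P.truncated_svd_eqI\<close> injectivity.\<close>
  have unique: "(\<forall>A. is_solution M r x y A \<and> minimality P.Cy A \<longrightarrow> A = adjoint (mp_inv P.S \<circ> U)) \<longleftrightarrow>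
      (\<exists>!V. is_truncated_svd r P.T V \<and> range V \<subseteq> range P.S)"
    if U: "is_truncated_svd r P.T U" "range U \<subseteq> range P.S" for U
  proof
    assume only: "\<forall>A. is_solution M r x y A \<and> minimality P.Cy A \<longrightarrow> A = adjoint (mp_inv P.S \<circ> U)"
    show "\<exists>!V. is_truncated_svd r P.T V \<and> range V \<subseteq> range P.S"
    proof (rule ex1I[of _ U])
      fix V assume V: "is_truncated_svd r P.T V \<and> range V \<subseteq> range P.S"
      then have "adjoint (mp_inv P.S \<circ> V) = adjoint (mp_inv P.S \<circ> U)" using only sol by blast
      then show "V = U" using P.truncated_svd_eqI U V by blast
    qed (use U in blast)
  next
    assume "\<exists>!V. is_truncated_svd r P.T V \<and> range V \<subseteq> range P.S"
    then have "V = U" if "is_truncated_svd r P.T V" "range V \<subseteq> range P.S" for V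
      using U that by blast
    then show "\<forall>A. is_solution M r x y A \<and> minimality P.Cy A \<longrightarrow> A = adjoint (mp_inv P.S \<circ> U)"
      using svd by blast
  qed
  have "(\<exists>A. is_solution M r x y A) \<longleftrightarrow>
      (\<exists>U. is_truncated_svd r P.T U \<and> range U \<subseteq> range P.S)"
    using sol(1) svd by metis
  then show ?thesis
    unfolding Cy S T P.orth_proj_closure_T Let_def
    by (intro conjI allI impI) ((elim conjE)?, (assumption | rule sol unique, assumption+))+
qed

end
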